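(* For any constants $A$ and $C$ there is a constant $B$ such that the following holds for all sufficiently large $n$ (depending on $A$ and $C$). Let $M$ be an arbitrary (real) $n\times n$ matrix whose entries have absolute value at most $n^C$, and let $N_n$ be the $n\times n$ random Bernoulli matrix. Then $$\mathbf{P}\big(\kappa(M+N_n)\ge n^B\big)\le n^{-A}.$$
   Context: The $n\times n$ random Bernoulli matrix is the random matrix whose entries are i.i.d. random variables taking the values $-1$ and $1$ with probability $1/2$ each. For an invertible $n\times n$ matrix $T$, the condition number is $\kappa(T)=\sigma_1(T)\,\sigma_1(T^{-1})$, where $\sigma_1(T)=\sup_{x\in\mathbb{R}^n,\|x\|=1}\|Tx\|$ is the largest singular value (Euclidean operator norm). Convention: $\kappa(T)=\infty$ if $T$ is singular. *)

theory Defs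
  imports
    "HOL-Probability.Probability"
    "Jordan_Normal_Form.Gauss_Jordan_Elimination"
begin

(* Matrices and vectors with explicit dimensions are used, since the constants of the theorem
   are chosen before the dimension n. *)

definition vec_l2_norm :: "real Matrix.vec \<Rightarrow> real" where
  "vec_l2_norm x = sqrt (scalar_prod x x)"

definition sigma1 :: "real mat \<Rightarrow> real" where
  "sigma1 T = (SUP x\<in>{x \<in> carrier_vec (dim_col T). vec_l2_norm x = 1}. vec_l2_norm (T *\<^sub>v x))"

(* For a square matrix, mat_inverse returns None exactly if the matrix is singular. *)
definition cond_number :: "real mat \<Rightarrow> ereal" where
  "cond_number T =
     (case mat_inverse T of
        Some S \<Rightarrow> ereal (sigma1 T * sigma1 S)
      | None \<Rightarrow> \<infinity>)"

(* The law of the n x n random Bernoulli matrix. The value 0 in Pi_pmf is only the default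
   outside the index set. *)
definition random_bernoulli_mat :: "nat \<Rightarrow> real mat pmf" where
  "random_bernoulli_mat n =
     map_pmf (Matrix.mat n n)
       (Pi_pmf ({..<n} \<times> {..<n}) 0 (\<lambda>_. pmf_of_set {-1, 1}))"

lemma cond_number_invertible:
  assumes "T \<in> carrier_mat n n" "S \<in> carrier_mat n n" "T * S = 1\<^sub>m n" "S * T = 1\<^sub>m n"
  shows "cond_number T = ereal (sigma1 T * sigma1 S)"
proof (cases "mat_inverse T")
  case None
  have "T \<notin> Units (ring_mat TYPE(real) n n)" using mat_inverse(1)[OF assms(1) None, where b = n] by simp
  then show ?thesis using assms by (auto simp: Units_def ring_mat_def)
next
  case (Some R)
  then have R: "T * R = 1\<^sub>m n" "R * T = 1\<^sub>m n" "R \<in> carrier_mat n n"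
    using mat_inverse(2)[OF assms(1)] by blast+
  have "R = R * (T * S)" using R(3) assms(3) by simp
  also have "\<dots> = (R * T) * S" by (rule assoc_mult_mat[symmetric, OF R(3) assms(1,2)])
  also have "\<dots> = S" using R(2) assms(2) by simp
  finally show ?thesis using Some by (simp add: cond_number_def)
qed

lemma cond_number_singular:
  assumes "T \<in> carrier_mat n n" "\<not> invertible_mat T"
  shows "cond_number T = \<infinity>"
proof (cases "mat_inverse T")
  case (Some R)
  then have "T * R = 1\<^sub>m n" "R * T = 1\<^sub>m n" "R \<in> carrier_mat n n"
    using mat_inverse(2)[OF assms(1)] by blast+
  then have "invertible_mat T" using assms(1)
    by (auto simp: invertible_mat_def inverts_mat_def)
  then show ?thesis using assms(2) by simp
qed (simp add: cond_number_def)

lemma random_bernoulli_mat_entry: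
  assumes "i < n" "j < n"
  shows "map_pmf (\<lambda>N. N $$ (i, j)) (random_bernoulli_mat n) = pmf_of_set {-1, 1}"
proof -
  have "map_pmf (\<lambda>N. N $$ (i, j)) (random_bernoulli_mat n)
      = map_pmf (\<lambda>f. f (i, j)) (Pi_pmf ({..<n} \<times> {..<n}) 0 (\<lambda>_. pmf_of_set {-1, 1}))"
    using assms by (simp add: random_bernoulli_mat_def map_pmf_comp)
  then show ?thesis using assms by (simp add: Pi_pmf_component)
qed

end

theory Submission
  imports Defs "Jordan_Normal_Form.Determinant" "HOL-Real_Asymp.Real_Asymp"
begin

text \<open>
  If \<open>T = M + N\<close> has a huge condition number, then for some row \<open>k\<close> every unit vector \<open>x\<close> orthogonal
  to the other rows is almost orthogonal to row \<open>k\<close>. Row \<open>k\<close> is independent of \<open>x\<close>, so this is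
  unlikely unless \<open>x\<close> is rich: the random sum \<open>\<xi> \<sqdot> x\<close> lies in some tiny interval with probability
  at least \<open>n\<^sup>-\<^sup>\<alpha>\<close>. It remains to see that, with high probability, no rich \<open>x\<close> is exactly orthogonal
  to \<open>n - 1\<close> random rows.

  Among boundedly many scales, two neighbours \<open>\<delta>\<close> and \<open>n\<^sup>c\<^sup>+\<^sup>3 \<delta>\<close> give comparable concentration
  probabilities, of size about \<open>\<rho>\<close>; round \<open>x / \<delta>\<close> to an integer vector. By Fourier analysis a
  fraction \<open>\<rho>\<close> of all frequencies \<open>u\<close> makes \<open>u x\<close> nearly integral in almost all coordinates;
  translating this set by multiples of one small frequency enlarges it by a factor of \<open>n\<^sup>1\<^sup>/\<^sup>4\<close>.
  By Parseval at most \<open>O(n\<^sup>-\<^sup>1\<^sup>/\<^sup>4 / \<rho>)\<close> integers correlate with the enlarged set, and almost all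
  coordinates are among them. A sample of \<open>O(log n)\<close> frequencies already determines a set of this size
  containing almost all coordinates, so there are few such sets. The number of candidate integer
  vectors is therefore much smaller than \<open>\<rho>\<^sup>-\<^sup>n\<close>, and a union bound suffices. Vectors with at most
  \<open>n\<^sup>7\<^sup>/\<^sup>8\<close> coordinates of non-negligible size are so few that the trivial probability \<open>1 / 2\<close> per row is
  enough for them.
\<close>

section \<open>Sign vectors and Fourier bounds\<close>

text \<open>The index set is left general so that one row (\<open>{..<n}\<close>) and a whole matrix
  (\<open>{..<n} \<times> {..<n}\<close>) are treated alike. The default 0 off \<open>I\<close>
  keeps every value at most 1 in modulus.\<close>

definition signs :: "'i set \<Rightarrow> ('i \<Rightarrow> real) pmf" where
  "signs I = Pi_pmf I 0 (\<lambda>_. pmf_of_set {-1, 1})"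

lemma finite_set_signs: "finite I \<Longrightarrow> finite (set_pmf (signs I))"
  unfolding signs_def by (subst set_Pi_pmf) (auto intro!: finite_PiE_dflt)

lemma integrable_signs: "finite I \<Longrightarrow> integrable (measure_pmf (signs I)) (h :: _ \<Rightarrow> real)"
  by (intro integrable_measure_pmf_finite finite_set_signs)

lemma expectation_signs_insert:
  assumes "finite I" "a \<notin> I"
  shows "measure_pmf.expectation (signs (insert a I)) (h :: _ \<Rightarrow> real) =
     (measure_pmf.expectation (signs I) (\<lambda>f. h (f(a := -1))) +
      measure_pmf.expectation (signs I) (\<lambda>f. h (f(a := 1)))) / 2"
proof -
  have "signs (insert a I) =
      bind_pmf (pmf_of_set {-1, 1}) (\<lambda>y. map_pmf (\<lambda>f. f(a := y)) (signs I))"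
    using assms by (simp add: signs_def Pi_pmf_insert' map_pmf_def)
  then have "measure_pmf.expectation (signs (insert a I)) h =
      (\<Sum>y\<in>{-1, 1}. pmf (pmf_of_set {-1, 1}) y *\<^sub>R
        measure_pmf.expectation (map_pmf (\<lambda>f. f(a := y)) (signs I)) h)"
    using assms by (simp only:) (rule pmf_expectation_bind, auto simp: finite_set_signs)
  then show ?thesis by (simp add: add_divide_distrib)
qed

lemma prob_eq_expectation_pmf:
  "measure_pmf.prob p S = measure_pmf.expectation p (indicat_real S)"
  by simp

lemma prob_signs_insert:
  assumes "finite I" "a \<notin> I"
  shows "measure_pmf.prob (signs (insert a I)) S =
     (measure_pmf.prob (signs I) {f. f(a := -1) \<in> S} +
      measure_pmf.prob (signs I) {f. f(a := 1) \<in> S}) / 2"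
proof -
  have *: "indicat_real S (f(a := y)) = indicat_real {f. f(a := y) \<in> S} f" for f y
    by (simp add: indicator_def)
  show ?thesis
    unfolding prob_eq_expectation_pmf expectation_signs_insert[OF assms] * by simp
qed

text \<open>Real form of the product formula for characteristic functions. The phase
  \<open>\<phi>\<close> makes the induction work: splitting off \<open>a\<close> shifts it by
  \<open>x a\<close> or \<open>- x a\<close>, and the mean of the two cosines of the shifted phase
  is \<open>cos \<phi> * cos (x a)\<close>.\<close>

lemma expectation_cos_signs:
  assumes "finite I"
  shows "measure_pmf.expectation (signs I) (\<lambda>\<xi>. cos ((\<Sum>i\<in>I. \<xi> i * x i) + \<phi>)) =
     (\<Prod>i\<in>I. cos (x i)) * cos \<phi>"
  using assms
proof (induction I arbitrary: \<phi> rule: finite_induct)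
  case empty
  show ?case by simp
next
  case (insert a I)
  have *: "(\<Sum>i\<in>insert a I. (f(a := y)) i * x i) + \<phi> = (\<Sum>i\<in>I. f i * x i) + (\<phi> + y * x a)" for f y
  proof -
    have "(\<Sum>i\<in>I. (f(a := y)) i * x i) = (\<Sum>i\<in>I. f i * x i)"
      using insert by (intro sum.cong) auto
    then show ?thesis using insert by simp
  qed
  show ?case
    unfolding expectation_signs_insert[OF insert(1,2)] * insert.IH
    using insert by (simp add: cos_add cos_diff field_simps)
qed

text \<open>Both sides are the squared modulus of the sum of \<open>exp (i * g u * y)\<close> over
  \<open>U\<close>. This serves twice: for the nonnegativity of the window majorant and for
  Parseval.\<close>

lemma sum_cos_diff_eq:
  "(\<Sum>u\<in>U. \<Sum>v\<in>U. cos ((g u - g v) * y)) = (\<Sum>u\<in>U. cos (g u * y))\<^sup>2 + (\<Sum>u\<in>U. sin (g u * y))\<^sup>2"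
  for y :: real and g :: "'b \<Rightarrow> real"
  by (simp add: power2_eq_square sum_product sum.distrib[symmetric] cos_diff left_diff_distrib)

text \<open>The squared modulus of \<open>\<Sum>u<G. exp (i u y)\<close> is nonnegative everywhere and at least \<open>G\<^sup>2 / 2\<close> for
  small \<open>y\<close>; as a majorant of the window it makes a finite sum do the work of an integral.\<close>
lemma small_ball_fourier:
  fixes x :: "'i \<Rightarrow> real"
  assumes I: "finite I" and G: "0 < G"
  shows "measure_pmf.prob (signs I) {\<xi>. \<bar>(\<Sum>i\<in>I. \<xi> i * x i) - z\<bar> \<le> 1}
    \<le> 2 / (real G)\<^sup>2 * (\<Sum>u<G. \<Sum>v<G. \<Prod>i\<in>I. \<bar>cos (pi * ((real u - real v) / (64 * real G)) * x i)\<bar>)"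
proof -
  \<comment> \<open>With \<open>\<bar>u - v\<bar> < G\<close> and a window of radius 1 the angle is
    at most \<open>pi / 64\<close>, well inside \<open>pi / 3\<close>, where the cosine is at least
    1/2. The generous 64 also keeps the later rounding errors small.\<close>
  define q where "q = pi / (64 * real G)"
  define F where "F \<xi> = 2 / (real G)\<^sup>2 * (\<Sum>u<G. \<Sum>v<G. cos ((real u - real v) * (q * ((\<Sum>i\<in>I. \<xi> i * x i) - z))))" for \<xi>
  have F0: "F \<xi> \<ge> 0" for \<xi>
    unfolding F_def sum_cos_diff_eq by simp
  have F1: "F \<xi> \<ge> 1" if "\<bar>(\<Sum>i\<in>I. \<xi> i * x i) - z\<bar> \<le> 1" for \<xi>
  proof -
    have "cos ((real u - real v) * (q * ((\<Sum>i\<in>I. \<xi> i * x i) - z))) \<ge> 1/2" if "u < G" "v < G" for u v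
    proof -
      have "\<bar>(real u - real v) * (q * ((\<Sum>i\<in>I. \<xi> i * x i) - z))\<bar> =
          \<bar>real u - real v\<bar> * (q * \<bar>(\<Sum>i\<in>I. \<xi> i * x i) - z\<bar>)"
        using G by (simp add: abs_mult q_def)
      also have "\<dots> \<le> real G * (q * 1)"
        using \<open>\<bar>(\<Sum>i\<in>I. \<xi> i * x i) - z\<bar> \<le> 1\<close> that G
        by (intro mult_mono) (auto simp: q_def)
      also have "\<dots> \<le> pi / 3" using G by (simp add: q_def)
      finally have le: "\<bar>(real u - real v) * (q * ((\<Sum>i\<in>I. \<xi> i * x i) - z))\<bar> \<le> pi / 3" .
      have "cos (pi / 3) \<le> cos \<bar>(real u - real v) * (q * ((\<Sum>i\<in>I. \<xi> i * x i) - z))\<bar>"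
        by (rule cos_monotone_0_pi_le) (use le pi_gt_zero in auto)
      then show ?thesis by (simp add: cos_60 cos_abs_real)
    qed
    then have "(\<Sum>u<G. \<Sum>v<G. cos ((real u - real v) * (q * ((\<Sum>i\<in>I. \<xi> i * x i) - z)))) \<ge> (\<Sum>u<G. \<Sum>v<G. 1/2)"
      by (intro sum_mono) auto
    then show ?thesis using G by (simp add: F_def field_simps power2_eq_square)
  qed
  have "measure_pmf.prob (signs I) {\<xi>. \<bar>(\<Sum>i\<in>I. \<xi> i * x i) - z\<bar> \<le> 1} \<le> measure_pmf.expectation (signs I) F"
    unfolding prob_eq_expectation_pmf
    by (intro integral_mono integrable_signs I) (use F0 F1 in \<open>auto simp: indicator_def\<close>)
  also have "\<dots> = 2 / (real G)\<^sup>2 * (\<Sum>u<G. \<Sum>v<G. measure_pmf.expectation (signs I)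
      (\<lambda>\<xi>. cos ((real u - real v) * (q * ((\<Sum>i\<in>I. \<xi> i * x i) - z)))))"
    unfolding F_def using I by (simp add: integrable_signs Bochner_Integration.integral_sum)
  also have "\<dots> \<le> 2 / (real G)\<^sup>2 * (\<Sum>u<G. \<Sum>v<G. \<Prod>i\<in>I. \<bar>cos (pi * ((real u - real v) / (64 * real G)) * x i)\<bar>)"
  proof (intro mult_left_mono sum_mono)
    fix u v
    have "(\<lambda>\<xi>. cos ((real u - real v) * (q * ((\<Sum>i\<in>I. \<xi> i * x i) - z)))) =
        (\<lambda>\<xi>. cos ((\<Sum>i\<in>I. \<xi> i * ((real u - real v) * q * x i)) + - ((real u - real v) * q * z)))"
      by (intro ext arg_cong[where f = cos])
         (simp add: sum_distrib_left right_diff_distrib mult_ac)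
    then have "measure_pmf.expectation (signs I) (\<lambda>\<xi>. cos ((real u - real v) * (q * ((\<Sum>i\<in>I. \<xi> i * x i) - z))))
        = (\<Prod>i\<in>I. cos ((real u - real v) * q * x i)) * cos (- ((real u - real v) * q * z))"
      by (simp only: expectation_cos_signs[OF I])
    also have "\<dots> \<le> \<bar>(\<Prod>i\<in>I. cos ((real u - real v) * q * x i)) * cos (- ((real u - real v) * q * z))\<bar>"
      by (rule abs_ge_self)
    also have "\<dots> \<le> \<bar>\<Prod>i\<in>I. cos ((real u - real v) * q * x i)\<bar> * 1"
      unfolding abs_mult by (intro mult_left_mono) auto
    also have "\<dots> = (\<Prod>i\<in>I. \<bar>cos (pi * ((real u - real v) / (64 * real G)) * x i)\<bar>)"
      by (simp add: abs_prod q_def mult_ac)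
    finally show "measure_pmf.expectation (signs I) (\<lambda>\<xi>. cos ((real u - real v) * (q * ((\<Sum>i\<in>I. \<xi> i * x i) - z)))) \<le> \<dots>" .
  qed auto
  finally show ?thesis .
qed

text \<open>Up to constants, the sum of the squared distances of \<open>t * x i\<close> to the nearest integers.\<close>
definition energy :: "'i set \<Rightarrow> ('i \<Rightarrow> real) \<Rightarrow> real \<Rightarrow> real" where
  "energy I x t = (\<Sum>i\<in>I. (sin (pi * t * x i))\<^sup>2)"

text \<open>Square root of \<open>1 - (sin y)\<^sup>2 \<le> exp (- (sin y)\<^sup>2)\<close>. It
  turns a product of cosines into an exponential of the energy.\<close>

lemma abs_cos_le_exp: "\<bar>cos y\<bar> \<le> exp (- ((sin y)\<^sup>2 / 2))" for y :: real
proof (rule power2_le_imp_le)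
  have "(cos y)\<^sup>2 = 1 + - (sin y)\<^sup>2" by (simp add: cos_squared_eq)
  also have "\<dots> \<le> exp (- (sin y)\<^sup>2)" by (rule exp_ge_add_one_self)
  also have "\<dots> = (exp (- ((sin y)\<^sup>2 / 2)))\<^sup>2" by (simp add: power2_eq_square mult_exp_exp)
  finally show "\<bar>cos y\<bar>\<^sup>2 \<le> (exp (- ((sin y)\<^sup>2 / 2)))\<^sup>2" by simp
qed simp

lemma prod_abs_cos_le:
  assumes "finite I"
  shows "(\<Prod>i\<in>I. \<bar>cos (pi * t * x i)\<bar>) \<le> exp (- energy I x t / 2)"
proof -
  have "(\<Prod>i\<in>I. \<bar>cos (pi * t * x i)\<bar>) \<le> (\<Prod>i\<in>I. exp (- ((sin (pi * t * x i))\<^sup>2 / 2)))"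
    by (intro prod_mono conjI abs_cos_le_exp) auto
  also have "\<dots> = exp (- energy I x t / 2)"
    using assms by (simp add: energy_def exp_sum[symmetric] sum_negf sum_divide_distrib)
  finally show ?thesis .
qed

text \<open>The Fourier sum is split by the frequency difference: a product of cosines is at most 1
  on \<open>A\<close> and at most \<open>exp (- m / 2)\<close> off it. Hence a concentrated sum
  forces many low-energy frequencies.\<close>

lemma small_ball_low_energy:
  fixes x :: "'i \<Rightarrow> real" and G :: nat and m :: real
  assumes I: "finite I" and G: "0 < G"
  defines "A \<equiv> {u \<in> {- int G<..<int G}. energy I x (of_int u / (64 * real G)) \<le> m}"
  shows "measure_pmf.prob (signs I) {\<xi>. \<bar>(\<Sum>i\<in>I. \<xi> i * x i) - z\<bar> \<le> 1}
    \<le> 2 * (card A / G + exp (- m / 2))"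
proof -
  have fin: "finite A" unfolding A_def by (rule finite_subset[of _ "{- int G<..<int G}"]) auto
  have inner: "(\<Sum>v<G. \<Prod>i\<in>I. \<bar>cos (pi * ((real u - real v) / (64 * real G)) * x i)\<bar>)
      \<le> card A + G * exp (- m / 2)" if u: "u < G" for u
  proof -
    have "(\<Sum>v<G. \<Prod>i\<in>I. \<bar>cos (pi * ((real u - real v) / (64 * real G)) * x i)\<bar>)
       \<le> (\<Sum>v<G. indicat_real A (int u - int v) + exp (- m / 2))"
    proof (intro sum_mono)
      fix v assume v: "v \<in> {..<G}"
      let ?t = "(real u - real v) / (64 * real G)"
      have le: "(\<Prod>i\<in>I. \<bar>cos (pi * ?t * x i)\<bar>) \<le> exp (- energy I x ?t / 2)"
        by (rule prod_abs_cos_le[OF I])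
      show "(\<Prod>i\<in>I. \<bar>cos (pi * ?t * x i)\<bar>) \<le> indicat_real A (int u - int v) + exp (- m / 2)"
      proof (cases "int u - int v \<in> A")
        case True
        have "(\<Prod>i\<in>I. \<bar>cos (pi * ?t * x i)\<bar>) \<le> (\<Prod>i\<in>I. 1)" by (intro prod_mono) auto
        then show ?thesis using True exp_ge_zero[of "-m/2"] by (simp add: add_increasing2)
      next
        case False
        then have "energy I x ?t > m" using u v by (auto simp: A_def)
        then have "exp (- energy I x ?t / 2) \<le> exp (- m / 2)" by simp
        with le have "(\<Prod>i\<in>I. \<bar>cos (pi * ?t * x i)\<bar>) \<le> exp (- m / 2)" by (rule order_trans)
        then show ?thesis using False by simp
      qed
    qed
    also have "\<dots> = (\<Sum>v<G. indicat_real A (int u - int v)) + G * exp (- m / 2)"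
      by (simp add: sum.distrib)
    \<comment> \<open>For fixed \<open>u\<close> the differences \<open>u - v\<close> are distinct,
      so each element of \<open>A\<close> is counted at most once.\<close>
    also have "(\<Sum>v<G. indicat_real A (int u - int v)) = (\<Sum>w\<in>(\<lambda>v. int u - int v) ` {..<G}. indicat_real A w)"
      by (subst sum.reindex) (auto simp: inj_on_def)
    also have "\<dots> = card (A \<inter> (\<lambda>v. int u - int v) ` {..<G})"
      by (simp add: indicator_def sum.If_cases Int_def conj_commute)
    also have "\<dots> \<le> card A" by (simp add: card_mono fin)
    finally show ?thesis by simp
  qed
  have "measure_pmf.prob (signs I) {\<xi>. \<bar>(\<Sum>i\<in>I. \<xi> i * x i) - z\<bar> \<le> 1}
    \<le> 2 / (real G)\<^sup>2 * (\<Sum>u<G. \<Sum>v<G. \<Prod>i\<in>I. \<bar>cos (pi * ((real u - real v) / (64 * real G)) * x i)\<bar>)"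
    by (rule small_ball_fourier[OF I G])
  also have "\<dots> \<le> 2 / (real G)\<^sup>2 * (\<Sum>u<G. card A + G * exp (- m / 2))"
    by (intro mult_left_mono sum_mono inner) auto
  also have "\<dots> = 2 * (card A / G + exp (- m / 2))"
    using G by (simp add: field_simps power2_eq_square)
  finally show ?thesis .
qed

section \<open>Energy under addition and translation of frequencies\<close>

lemma sin_add_squared_le: "(sin (a + b))\<^sup>2 \<le> 2 * (sin a)\<^sup>2 + 2 * (sin b)\<^sup>2" for a b :: real
proof -
  have "\<bar>sin (a + b)\<bar> \<le> \<bar>sin a\<bar> * \<bar>cos b\<bar> + \<bar>cos a\<bar> * \<bar>sin b\<bar>"
    unfolding sin_add abs_mult[symmetric] by (rule abs_triangle_ineq)
  also have "\<dots> \<le> \<bar>sin a\<bar> * 1 + 1 * \<bar>sin b\<bar>"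
    by (intro add_mono mult_mono) auto
  finally have "(sin (a + b))\<^sup>2 \<le> (\<bar>sin a\<bar> + \<bar>sin b\<bar>)\<^sup>2"
    by (simp add: abs_le_square_iff[symmetric])
  also have "\<dots> \<le> 2 * (sin a)\<^sup>2 + 2 * (sin b)\<^sup>2"
    using zero_le_power2[of "\<bar>sin a\<bar> - \<bar>sin b\<bar>"] by (simp add: power2_eq_square algebra_simps)
  finally show ?thesis .
qed

text \<open>Makes low-energy frequencies an approximate group: sums and differences of two
  frequencies of energy at most \<open>m\<close> have energy at most \<open>4 * m\<close>.\<close>

lemma energy_add_le: "energy I x (s + t) \<le> 2 * energy I x s + 2 * energy I x t"
  unfolding energy_def sum_distrib_left sum.distrib[symmetric]
  by (intro sum_mono) (simp add: sin_add_squared_le distrib_left distrib_right)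

lemma energy_minus [simp]: "energy I x (- t) = energy I x t"
  by (simp add: energy_def)

lemma sin_squared_le: "(sin y)\<^sup>2 \<le> y\<^sup>2" for y :: real
  using abs_sin_x_le_abs_x[of y] by (simp add: abs_le_square_iff[symmetric])

text \<open>On \<open>[0, 1]\<close> the function \<open>sin z - z / 2\<close> has derivative
  \<open>cos z - 1 / 2\<close>, nonnegative because \<open>1 < pi / 3\<close>; oddness covers
  negative arguments.\<close>

lemma sin_squared_ge:
  fixes y :: real
  assumes "\<bar>y\<bar> \<le> 1"
  shows "y\<^sup>2 / 4 \<le> (sin y)\<^sup>2"
proof -
  have *: "y / 2 \<le> sin y" if "0 \<le> y" "y \<le> 1" for y :: real
  proof -
    have "sin 0 - 0 / 2 \<le> sin y - y / 2"
    proof (rule DERIV_nonneg_imp_nondecreasing[OF that(1)])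
      fix z :: real assume z: "0 \<le> z" "z \<le> y"
      have "cos (pi / 3) \<le> cos z"
        by (rule cos_monotone_0_pi_le) (use z that pi_gt3 in auto)
      then show "\<exists>d. ((\<lambda>z. sin z - z / 2) has_real_derivative d) (at z) \<and> 0 \<le> d"
        by (intro exI[of _ "cos z - 1 / 2"]) (auto intro!: derivative_eq_intros simp: cos_60)
    qed
    then show ?thesis by simp
  qed
  have "\<bar>y\<bar> / 2 \<le> \<bar>sin y\<bar>" using *[of "\<bar>y\<bar>"] assms
    by (cases "y \<ge> 0") (auto simp: abs_if)
  then have "\<bar>y / 2\<bar> \<le> \<bar>sin y\<bar>" by simp
  then show ?thesis by (simp only: abs_le_square_iff) (simp add: power_divide)
qed

text \<open>The translates of \<open>A\<close> by multiples of \<open>s\<close> are disjoint: differences of elements of \<open>A\<close> have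
  energy at most \<open>4 * m\<close>.\<close>
lemma card_translates_le:
  fixes I :: "'i set" and x :: "'i \<Rightarrow> real" and G k s :: nat and m e Q :: real
  defines "A \<equiv> {u \<in> {- int G<..<int G}. energy I x (of_int u / Q) \<le> m}"
  assumes sep: "\<And>l. 1 \<le> l \<Longrightarrow> l < k \<Longrightarrow> 4 * m < energy I x (real (l * s) / Q)"
    and small: "\<And>l. l < k \<Longrightarrow> energy I x (real (l * s) / Q) \<le> e"
    and range: "k * s \<le> G"
  shows "k * card A \<le> card {u \<in> {- int (2 * G)<..<int (2 * G)}. energy I x (of_int u / Q) \<le> 2 * m + 2 * e}"
proof -
  let ?h = "\<lambda>(l, u). u + int (l * s)"
  have sep': "l = l'" if "l' \<le> l" "l < k" "u \<in> A" "u' \<in> A" "u + int (l * s) = u' + int (l' * s)" for l l' u u'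
  proof (rule ccontr)
    assume "l \<noteq> l'"
    with that have "4 * m < energy I x (real ((l - l') * s) / Q)" by (intro sep) auto
    also have "real ((l - l') * s) / Q = of_int u' / Q + - (of_int u / Q)"
    proof -
      have "int ((l - l') * s) = u' - u" using that by (simp add: of_nat_diff algebra_simps)
      then have "real ((l - l') * s) = of_int (u' - u)" by (metis of_int_of_nat_eq)
      then show ?thesis by (simp only:) (simp add: diff_divide_distrib)
    qed
    also have "energy I x \<dots> \<le> 2 * energy I x (of_int u' / Q) + 2 * energy I x (of_int u / Q)"
      using energy_add_le[of I x "of_int u' / Q" "- (of_int u / Q)"] by simp
    also have "\<dots> \<le> 4 * m" using that by (auto simp: A_def)
    finally show False by simp
  qed
  have inj: "inj_on ?h ({..<k} \<times> A)"
  proof (rule inj_onI, clarsimp)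
    fix l l' u u'
    assume a: "l < k" "u \<in> A" "l' < k" "u' \<in> A" "u + int l * int s = u' + int l' * int s"
    have "l = l'"
    proof (cases "l' \<le> l")
      case True
      then show ?thesis using sep'[of l' l u u'] a by simp
    next
      case False
      then show ?thesis using sep'[of l l' u' u] a by simp
    qed
    then show "l = l' \<and> u = u'" using a by simp
  qed
  have "k * card A = card (?h ` ({..<k} \<times> A))"
    by (subst card_image[OF inj]) (simp add: card_cartesian_product)
  also have "\<dots> \<le> card {u \<in> {- int (2 * G)<..<int (2 * G)}. energy I x (of_int u / Q) \<le> 2 * m + 2 * e}"
  proof (rule card_mono)
    show "finite {u \<in> {- int (2 * G)<..<int (2 * G)}. energy I x (of_int u / Q) \<le> 2 * m + 2 * e}"
      by (rule finite_subset[of _ "{- int (2 * G)<..<int (2 * G)}"]) auto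
    show "?h ` ({..<k} \<times> A) \<subseteq> {u \<in> {- int (2 * G)<..<int (2 * G)}. energy I x (of_int u / Q) \<le> 2 * m + 2 * e}"
    proof
      fix w assume "w \<in> ?h ` ({..<k} \<times> A)"
      then obtain l u where w: "w = u + int (l * s)" and l: "l \<in> {..<k}" and u: "u \<in> A"
        by (auto simp del: of_nat_mult)
      have "l * s \<le> G" using l range by (meson le_trans lessThan_iff less_imp_le_nat mult_le_mono1)
      then have ls: "int (l * s) \<le> int G" "0 \<le> int (l * s)" by (simp_all only: of_nat_le_iff of_nat_0_le_iff)
      have "of_int (u + int (l * s)) / Q = of_int u / Q + real (l * s) / Q"
        by (simp add: add_divide_distrib)
      then have "energy I x (of_int (u + int (l * s)) / Q) \<le> 2 * energy I x (of_int u / Q) + 2 * energy I x (real (l * s) / Q)"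
        by (metis energy_add_le)
      also have "\<dots> \<le> 2 * m + 2 * e"
        using u small[of l] l by (intro add_mono mult_left_mono) (auto simp: A_def)
      finally have "energy I x (of_int w / Q) \<le> 2 * m + 2 * e" by (simp only: w)
      moreover have "w \<in> {- int (2 * G)<..<int (2 * G)}"
        using u ls by (auto simp: A_def w simp del: of_nat_mult)
      ultimately show "w \<in> {u \<in> {- int (2 * G)<..<int (2 * G)}. energy I x (of_int u / Q) \<le> 2 * m + 2 * e}"
        by blast
    qed
  qed
  finally show ?thesis .
qed

text \<open>The price of a translation: coordinates above \<open>\<tau>\<close> may wrap around and
  are charged the trivial 1, all others \<open>c\<^sup>2\<close>.\<close>

lemma energy_low_coords_le:
  fixes c :: real
  assumes I: "finite I" and c: "\<And>i. i \<in> I \<Longrightarrow> \<bar>x i\<bar> \<le> \<tau> \<Longrightarrow> \<bar>pi * t * x i\<bar> \<le> c"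
  shows "energy I x t \<le> card {i\<in>I. \<tau> < \<bar>x i\<bar>} + card I * c\<^sup>2"
proof -
  have "energy I x t \<le> (\<Sum>i\<in>I. (if \<tau> < \<bar>x i\<bar> then 1 else 0 :: real) + c\<^sup>2)"
    unfolding energy_def
  proof (rule sum_mono)
    fix i assume i: "i \<in> I"
    show "(sin (pi * t * x i))\<^sup>2 \<le> (if \<tau> < \<bar>x i\<bar> then 1 else 0 :: real) + c\<^sup>2"
    proof (cases "\<tau> < \<bar>x i\<bar>")
      case True
      have "(sin (pi * t * x i))\<^sup>2 \<le> 1" by (simp add: abs_square_le_1)
      then show ?thesis using True by (simp add: add_increasing2)
    next
      case False
      then have "\<bar>pi * t * x i\<bar> \<le> \<bar>c\<bar>" using c[OF i] by linarith
      then have "(pi * t * x i)\<^sup>2 \<le> c\<^sup>2" by (simp only: abs_le_square_iff)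
      then show ?thesis using False sin_squared_le[of "pi * t * x i"] by simp
    qed
  qed
  also have "\<dots> = card {i\<in>I. \<tau> < \<bar>x i\<bar>} + card I * c\<^sup>2"
    using I by (simp add: sum.distrib sum.If_cases Int_def)
  finally show ?thesis .
qed

text \<open>Source of the disjointness of translates: while the angles do not exceed 1, the sine is
  comparable to its argument, so no coordinate in \<open>J\<close> wraps around.\<close>

lemma energy_ge_card:
  assumes I: "finite I" and J: "J \<subseteq> I" and "0 \<le> c" and c: "\<And>i. i \<in> J \<Longrightarrow> c \<le> \<bar>pi * t * x i\<bar> \<and> \<bar>pi * t * x i\<bar> \<le> 1"
  shows "card J * (c\<^sup>2 / 4) \<le> energy I x t"
proof -
  have "card J * (c\<^sup>2 / 4) = (\<Sum>i\<in>J. c\<^sup>2 / 4)" by simp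
  also have "\<dots> \<le> (\<Sum>i\<in>J. (sin (pi * t * x i))\<^sup>2)"
  proof (rule sum_mono)
    fix i assume i: "i \<in> J"
    have "\<bar>c\<bar> \<le> \<bar>pi * t * x i\<bar>" using c[OF i] \<open>0 \<le> c\<close> by simp
    then have "c\<^sup>2 \<le> (pi * t * x i)\<^sup>2" by (simp only: abs_le_square_iff)
    then show "c\<^sup>2 / 4 \<le> (sin (pi * t * x i))\<^sup>2"
      using sin_squared_ge[of "pi * t * x i"] c[OF i] by simp
  qed
  also have "\<dots> \<le> energy I x t"
    unfolding energy_def using I J by (intro sum_mono2) auto
  finally show ?thesis .
qed

text \<open>The shift \<open>s\<close> is chosen so small that its multiples below \<open>k\<close> do not wrap around the unit circle on
  the coordinates of size at most \<open>\<tau>\<close>, where the energy then grows quadratically.\<close>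
lemma card_low_energy_gain:
  fixes x :: "'i \<Rightarrow> real" and G k :: nat and m c v \<tau> :: real
  assumes I: "finite I" and G: "0 < G" and k: "0 < k" and v: "0 < v" "v \<le> \<tau>" and c: "0 < c" "c \<le> 1"
    and \<tau>: "64 \<le> \<tau>" and G': "2 * pi * k * \<tau> \<le> c * (64 * real G)"
    and m: "4 * m < card {i\<in>I. v < \<bar>x i\<bar> \<and> \<bar>x i\<bar> \<le> \<tau>} * ((c * v / (2 * k * \<tau>))\<^sup>2 / 4)"
  shows "k * card {u \<in> {- int G<..<int G}. energy I x (of_int u / (64 * real G)) \<le> m}
    \<le> card {u \<in> {- int (2 * G)<..<int (2 * G)}. energy I x (of_int u / (64 * real G))
        \<le> 2 * m + 2 * (card {i\<in>I. \<tau> < \<bar>x i\<bar>} + card I * c\<^sup>2)}"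
proof (rule card_translates_le)
  define Q where "Q = 64 * real G"
  \<comment> \<open>\<open>r\<close> solves \<open>pi * (k * r / Q) * \<tau> = c\<close>, and the
    shift \<open>s\<close> is its floor. Since \<open>2 \<le> r\<close>, flooring loses at most a
    factor 2, whence the 2 in \<open>c * v / (2 * k * \<tau>)\<close>.\<close>
  define r where "r = c * Q / (pi * k * \<tau>)"
  have pos: "0 < Q" "0 < \<tau>" "0 < real k" using G \<tau> k by (auto simp: Q_def)
  define s where "s = nat \<lfloor>r\<rfloor>"
  have r2: "2 \<le> r" using G' pos by (simp add: r_def Q_def field_simps)
  then have s: "real s \<le> r" "r / 2 \<le> real s" unfolding s_def by linarith+
  have kst: "pi * (k * s / Q) * \<tau> \<le> c"
  proof -
    have "pi * (k * s / Q) * \<tau> \<le> pi * (k * r / Q) * \<tau>"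
      using s pos by (intro mult_right_mono mult_left_mono divide_right_mono) auto
    also have "\<dots> = c" using pos by (simp add: r_def)
    finally show ?thesis .
  qed
  have upper: "\<bar>pi * (real (l * s) / Q) * x i\<bar> \<le> c" if "l < k" "\<bar>x i\<bar> \<le> \<tau>" for l i
  proof -
    have "\<bar>pi * (real (l * s) / Q) * x i\<bar> = pi * (l * s / Q) * \<bar>x i\<bar>"
      using pos by (simp add: abs_mult)
    also have "\<dots> \<le> pi * (k * s / Q) * \<tau>"
      using that pos by (intro mult_mono divide_right_mono) (auto intro!: mult_right_mono)
    finally show ?thesis using kst by simp
  qed
  have lower: "c * v / (2 * k * \<tau>) \<le> \<bar>pi * (real (l * s) / Q) * x i\<bar>" if "1 \<le> l" "v < \<bar>x i\<bar>" for l i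
  proof -
    have "c * v / (2 * k * \<tau>) = pi * (1 * (r / 2) / Q) * v"
      using pos by (simp add: r_def field_simps)
    also have "\<dots> \<le> pi * (l * s / Q) * \<bar>x i\<bar>"
    proof -
      have "1 * (r / 2) \<le> real l * real s" using that s r2 by (intro mult_mono) auto
      then have "1 * (r / 2) / Q \<le> l * s / Q" using pos by (intro divide_right_mono) auto
      then show ?thesis using that pos r2 v by (intro mult_mono) auto
    qed
    also have "\<dots> = \<bar>pi * (real (l * s) / Q) * x i\<bar>"
      using pos by (simp add: abs_mult)
    finally show ?thesis .
  qed
  show "4 * m < energy I x (real (l * s) / (64 * real G))" if "1 \<le> l" "l < k" for l
  proof -
    have "card {i\<in>I. v < \<bar>x i\<bar> \<and> \<bar>x i\<bar> \<le> \<tau>} * ((c * v / (2 * k * \<tau>))\<^sup>2 / 4) \<le> energy I x (real (l * s) / Q)"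
    proof (rule energy_ge_card[OF I])
      fix i assume "i \<in> {i \<in> I. v < \<bar>x i\<bar> \<and> \<bar>x i\<bar> \<le> \<tau>}"
      then show "c * v / (2 * k * \<tau>) \<le> \<bar>pi * (real (l * s) / Q) * x i\<bar> \<and> \<bar>pi * (real (l * s) / Q) * x i\<bar> \<le> 1"
        using lower[of l i] upper[of l i] that c by auto
    qed (use pos c v in auto)
    then show ?thesis using m by (simp add: Q_def)
  qed
  show "energy I x (real (l * s) / (64 * real G)) \<le> card {i\<in>I. \<tau> < \<bar>x i\<bar>} + card I * c\<^sup>2" if "l < k" for l
    using energy_low_coords_le[OF I, of x \<tau> "real (l * s) / Q" c] upper[OF that] by (simp add: Q_def)
  show "k * s \<le> G"
  proof -
    have "pi * (k * s / Q) * 64 \<le> pi * (k * s / Q) * \<tau>"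
      using \<tau> pos by (intro mult_left_mono) auto
    also have "\<dots> \<le> 1" using kst c by simp
    finally have "pi * (k * s) \<le> G" using G by (simp add: Q_def field_simps)
    moreover have "1 * real (k * s) \<le> pi * (k * s)" using pi_gt3 by (intro mult_mono) auto
    ultimately show ?thesis by (metis mult_1 of_nat_le_iff of_nat_mult order_trans)
  qed
qed

section \<open>Parseval over the residues modulo \<open>2 * P\<close>\<close>

text \<open>Telescoping: multiplication by \<open>2 * sin (y / 2)\<close> turns each cosine into a
  difference of consecutive sines.\<close>

lemma sum_cos_arith_progression:
  fixes y c :: real
  shows "2 * sin (y / 2) * (\<Sum>j<N. cos ((real j + c) * y)) = sin ((real N + c - 1/2) * y) - sin ((c - 1/2) * y)"
proof (induction N)
  case (Suc N)
  have "2 * sin (y / 2) * cos ((real N + c) * y) = sin ((real N + c) * y + y / 2) - sin ((real N + c) * y - y / 2)"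
    by (simp add: sin_add sin_diff)
  then show ?case using Suc by (simp add: algebra_simps)
qed simp

text \<open>\<open>b\<close> runs through a full residue system modulo \<open>2 * P\<close>, over
  which a nontrivial character sums to zero. The bounds on \<open>w\<close> ensure nontriviality;
  the two ends of the telescoped sum differ by \<open>w\<close> full turns.\<close>

lemma sum_cos_complete_residues:
  fixes w :: int and P :: nat
  assumes "w \<noteq> 0" "\<bar>w\<bar> < 2 * int P"
  shows "(\<Sum>b\<in>{- int P..<int P}. cos (of_int b * (pi * of_int w / real P))) = 0"
proof -
  have P: "0 < P" using assms by auto
  define y where "y = pi * of_int w / real P"
  have "sin (y / 2) \<noteq> 0"
  proof
    assume "sin (y / 2) = 0"
    then obtain i :: int where i: "y / 2 = of_int i * pi" by (auto simp: sin_zero_iff_int2)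
    then have "of_int w = (2 * of_int i * real P :: real)" using P by (simp add: y_def field_simps)
    then have w: "w = 2 * i * int P" by (metis (mono_tags, lifting) of_int_eq_iff of_int_mult of_int_numeral of_int_of_nat_eq)
    with assms have "i \<noteq> 0" by auto
    then have "1 * (2 * int P) \<le> \<bar>i\<bar> * (2 * int P)" by (intro mult_right_mono) auto
    then show False using assms w by (simp add: abs_mult)
  qed
  moreover have "2 * sin (y / 2) * (\<Sum>j<2 * P. cos ((real j + - real P) * y)) = 0"
  proof -
    have "(real (2 * P) + - real P - 1/2) * y = (- real P - 1/2) * y + 2 * pi * of_int w"
      using P by (simp add: y_def field_simps)
    then have "sin ((real (2 * P) + - real P - 1/2) * y) = sin ((- real P - 1/2) * y)"
      by (simp only: sin_add sin_int_2pin cos_int_2pin)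
    then show ?thesis unfolding sum_cos_arith_progression by simp
  qed
  ultimately have "(\<Sum>j<2 * P. cos ((real j + - real P) * y)) = 0" by simp
  also have "(\<Sum>j<2 * P. cos ((real j + - real P) * y)) = (\<Sum>b\<in>(\<lambda>j. int j - int P) ` {..<2 * P}. cos (of_int b * y))"
    by (subst sum.reindex) (auto simp: inj_on_def)
  also have "(\<lambda>j. int j - int P) ` {..<2 * P} = {- int P..<int P}"
  proof (auto simp: image_iff)
    fix b assume "- int P \<le> b" "b < int P"
    then show "\<exists>j\<in>{..<2 * P}. b = int j - int P" by (intro bexI[of _ "nat (b + int P)"]) auto
  qed
  finally show ?thesis by (simp add: y_def)
qed

text \<open>The squared moduli of the transform of \<open>S\<close> sum to
  \<open>2 * P * card S\<close>, and each \<open>b\<close> in \<open>Y\<close> accounts for at least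
  \<open>(card S / 4)\<^sup>2\<close>. The bound on differences makes the elements of
  \<open>S\<close> distinct residues.\<close>

lemma card_large_spectrum_le:
  fixes P :: nat
  assumes S: "finite S" "S \<noteq> {}" "\<And>u v. u \<in> S \<Longrightarrow> v \<in> S \<Longrightarrow> \<bar>u - v\<bar> < 2 * int P"
    and Y: "Y \<subseteq> {- int P..<int P}" "\<And>b. b \<in> Y \<Longrightarrow> card S / 4 \<le> (\<Sum>u\<in>S. cos (2 * pi * (of_int u / (2 * real P)) * of_int b))"
  shows "real (card Y) * real (card S) \<le> 32 * real P"
proof -
  define F where "F b = (\<Sum>u\<in>S. cos (of_int u * (pi * of_int b / P)))\<^sup>2 + (\<Sum>u\<in>S. sin (of_int u * (pi * of_int b / P)))\<^sup>2" for b :: int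
  have fY: "finite Y" using Y(1) finite_subset by blast
  have "card Y * (card S / 4)\<^sup>2 = (\<Sum>b\<in>Y. (card S / 4)\<^sup>2)" by simp
  also have "\<dots> \<le> (\<Sum>b\<in>Y. F b)"
  proof (rule sum_mono)
    fix b assume b: "b \<in> Y"
    have "card S / 4 \<le> (\<Sum>u\<in>S. cos (of_int u * (pi * of_int b / P)))"
      using Y(2)[OF b] by (simp add: mult_ac)
    then have "(card S / 4)\<^sup>2 \<le> (\<Sum>u\<in>S. cos (of_int u * (pi * of_int b / P)))\<^sup>2"
      by (rule power_mono) auto
    then show "(card S / 4)\<^sup>2 \<le> F b" by (simp add: F_def add_increasing2)
  qed
  also have "\<dots> \<le> (\<Sum>b\<in>{- int P..<int P}. F b)"
    using Y(1) by (intro sum_mono2) (auto simp: F_def)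
  also have "\<dots> = (\<Sum>b\<in>{- int P..<int P}. \<Sum>u\<in>S. \<Sum>v\<in>S. cos ((of_int u - of_int v) * (pi * of_int b / P)))"
    by (simp only: F_def sum_cos_diff_eq)
  also have "\<dots> = (\<Sum>u\<in>S. \<Sum>v\<in>S. \<Sum>b\<in>{- int P..<int P}. cos ((of_int u - of_int v) * (pi * of_int b / P)))"
    by (subst sum.swap) (intro sum.cong refl sum.swap)
  also have "\<dots> = (\<Sum>u\<in>S. \<Sum>v\<in>S. if u = v then 2 * real P else 0)"
  proof (intro sum.cong refl)
    fix u v assume uv: "u \<in> S" "v \<in> S"
    show "(\<Sum>b\<in>{- int P..<int P}. cos ((of_int u - of_int v) * (pi * of_int b / P))) = (if u = v then 2 * real P else 0)"
    proof (cases "u = v")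
      case False
      have "(\<Sum>b\<in>{- int P..<int P}. cos ((of_int u - of_int v) * (pi * of_int b / P)))
          = (\<Sum>b\<in>{- int P..<int P}. cos (of_int b * (pi * of_int (u - v) / real P)))"
        by (simp add: mult_ac)
      also have "\<dots> = 0" using False S(3)[OF uv] by (intro sum_cos_complete_residues) auto
      finally show ?thesis using False by simp
    qed simp
  qed
  also have "\<dots> = 2 * real P * card S" using S(1) by simp
  finally have "(card Y * card S) * (real (card S) / 16) \<le> (32 * real P) * (real (card S) / 16)"
    by (simp add: power2_eq_square field_simps)
  moreover have "0 < card S" using S by (simp add: card_gt_0_iff)
  ultimately show ?thesis by (subst (asm) mult_le_cancel_right) auto
qed

section \<open>Structure of rich vectors\<close>

lemma exp_le_quadratic:
  fixes y :: real
  assumes "\<bar>y\<bar> \<le> 1"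
  shows "exp y \<le> 1 + y + y\<^sup>2"
proof (cases "0 \<le> y")
  case True
  then show ?thesis using exp_bound[of y] assms by simp
next
  case False
  define x where "x = - y"
  have x: "0 \<le> x" using False by (simp add: x_def)
  \<comment> \<open>Since \<open>exp x\<close> dominates its quadratic Taylor polynomial, a product
    of at least 1 shows that \<open>1 - x + x\<^sup>2\<close> dominates
    \<open>exp (- x)\<close>.\<close>
  have "1 * 1 \<le> (1 - x + x\<^sup>2) * (1 + x + x\<^sup>2 / 2)"
  proof -
    have "(1 - x + x\<^sup>2) * (1 + x + x\<^sup>2 / 2) = 1 + x\<^sup>2 / 2 + x ^ 3 / 2 + x ^ 4 / 2"
      by (simp add: field_simps power2_eq_square power3_eq_cube power4_eq_xxxx)
    then show ?thesis using x by simp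
  qed
  also have "\<dots> \<le> (1 - x + x\<^sup>2) * exp x"
  proof (rule mult_left_mono)
    show "1 + x + x\<^sup>2 / 2 \<le> exp x" using exp_lower_Taylor_quadratic[OF x] by simp
    show "0 \<le> 1 - x + x\<^sup>2" using zero_le_power2[of "x - 1/2"] by (simp add: power2_eq_square algebra_simps)
  qed
  finally show ?thesis by (simp add: x_def exp_minus field_simps)
qed

section \<open>Sampling frequencies\<close>

text \<open>Exponential moments with parameter 1/32, phrased as a count of samples with replacement.
  The linear terms cancel and \<open>\<bar>g u / 32\<bar> \<le> 1 / 16\<close>, so one sample has
  moment at most \<open>1 + 1 / 256\<close>; the threshold contributes \<open>exp (m / 128)\<close>,
  which leaves \<open>exp (- m / 256)\<close>.\<close>

lemma card_samples_deviating_le: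
  fixes g :: "'a \<Rightarrow> real" and m :: nat
  assumes S: "finite S" and g: "(\<Sum>u\<in>S. g u) = 0" "\<And>u. u \<in> S \<Longrightarrow> \<bar>g u\<bar> \<le> 2"
  shows "card {us \<in> {..<m} \<rightarrow>\<^sub>E S. m / 4 \<le> (\<Sum>l<m. g (us l))} \<le> (real (card S)) ^ m * exp (- m / 256)"
proof -
  let ?W = "{us \<in> {..<m} \<rightarrow>\<^sub>E S. m / 4 \<le> (\<Sum>l<m. g (us l))}"
  have fin: "finite ({..<m} \<rightarrow>\<^sub>E S)" using S by (intro finite_PiE) auto
  have "card ?W * exp (m / 128) = (\<Sum>us\<in>?W. exp (1 / 32 * (m / 4)))" by simp
  also have "\<dots> \<le> (\<Sum>us\<in>?W. exp (1 / 32 * (\<Sum>l<m. g (us l))))"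
    by (intro sum_mono) auto
  also have "\<dots> \<le> (\<Sum>us\<in>{..<m} \<rightarrow>\<^sub>E S. exp (1 / 32 * (\<Sum>l<m. g (us l))))"
    by (intro sum_mono2 fin) auto
  also have "\<dots> = (\<Sum>us\<in>{..<m} \<rightarrow>\<^sub>E S. \<Prod>l<m. exp (g (us l) / 32))"
    by (simp add: exp_sum[symmetric] sum_divide_distrib)
  also have "\<dots> = (\<Prod>l<m. \<Sum>u\<in>S. exp (g u / 32))"
    using S by (intro prod_sum_PiE[symmetric]) auto
  also have "\<dots> = (\<Sum>u\<in>S. exp (g u / 32)) ^ m" by simp
  also have "\<dots> \<le> (card S * exp (1 / 256)) ^ m"
  proof (rule power_mono)
    have "(\<Sum>u\<in>S. exp (g u / 32)) \<le> (\<Sum>u\<in>S. (1 + 1 / 256) + g u / 32)"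
    proof (rule sum_mono)
      fix u assume u: "u \<in> S"
      have "exp (g u / 32) \<le> 1 + g u / 32 + (g u / 32)\<^sup>2"
        using g(2)[OF u] by (intro exp_le_quadratic) auto
      also have "\<bar>g u / 32\<bar> \<le> 1 / 16" using g(2)[OF u] by simp
      then have "(g u / 32)\<^sup>2 \<le> 1 / 256"
        using power_mono[of "\<bar>g u / 32\<bar>" "1 / 16" 2] by (simp add: power_divide)
      finally show "exp (g u / 32) \<le> (1 + 1 / 256) + g u / 32" by simp
    qed
    also have "\<dots> = card S * (1 + 1 / 256)"
      using g(1) by (simp add: sum.distrib sum_divide_distrib[symmetric])
    also have "\<dots> \<le> card S * exp (1 / 256)"
      by (intro mult_left_mono exp_ge_add_one_self) auto
    finally show "(\<Sum>u\<in>S. exp (g u / 32)) \<le> card S * exp (1 / 256)" .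
  qed (auto intro: sum_nonneg)
  also have "\<dots> = (real (card S)) ^ m * exp (- m / 256) * exp (m / 128)"
    by (simp add: power_mult_distrib exp_of_nat_mult[symmetric] mult_exp_exp)
  finally show ?thesis by simp
qed

text \<open>Union bound over both tails for every \<open>b\<close>: the hypothesis on
  \<open>m\<close> leaves a sample all of whose means are within 1/4 of the true ones. The test
  level 1/2 then separates 3/4 from 1/4.\<close>

lemma exists_good_sample:
  fixes c :: "'b \<Rightarrow> 'a \<Rightarrow> real" and m :: nat
  assumes S: "finite S" "S \<noteq> {}" and B: "finite B" and c: "\<And>b u. \<bar>c b u\<bar> \<le> 1"
    and m: "2 * real (card B) * exp (- m / 256) < 1"
  obtains us where "us \<in> {..<m} \<rightarrow>\<^sub>E S"
    "\<And>b. b \<in> B \<Longrightarrow> 3 / 4 * card S \<le> (\<Sum>u\<in>S. c b u) \<Longrightarrow> m / 2 \<le> (\<Sum>l<m. c b (us l))"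
    "\<And>b. b \<in> B \<Longrightarrow> m / 2 \<le> (\<Sum>l<m. c b (us l)) \<Longrightarrow> card S / 4 \<le> (\<Sum>u\<in>S. c b u)"
proof -
  define \<mu> where "\<mu> b = (\<Sum>u\<in>S. c b u) / card S" for b
  have cS: "0 < card S" using S by (simp add: card_gt_0_iff)
  define W where "W b = {us \<in> {..<m} \<rightarrow>\<^sub>E S. m / 4 \<le> (\<Sum>l<m. \<mu> b - c b (us l))}" for b
  define V where "V b = {us \<in> {..<m} \<rightarrow>\<^sub>E S. m / 4 \<le> (\<Sum>l<m. c b (us l) - \<mu> b)}" for b
  define e where "e = (real (card S)) ^ m * exp (- m / 256)"
  have \<mu>: "\<bar>\<mu> b\<bar> \<le> 1" for b
  proof -
    have "\<bar>\<Sum>u\<in>S. c b u\<bar> \<le> (\<Sum>u\<in>S. 1)" by (rule order_trans[OF sum_abs sum_mono]) (rule c)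
    then show ?thesis using cS by (simp add: \<mu>_def abs_divide divide_le_eq)
  qed
  have \<mu>S: "(\<Sum>u\<in>S. c b u) = card S * \<mu> b" for b using cS by (simp add: \<mu>_def)
  have WV: "real (card (W b)) \<le> e" "real (card (V b)) \<le> e" for b
  proof -
    have d: "\<bar>\<mu> b - c b u\<bar> \<le> 2" "\<bar>c b u - \<mu> b\<bar> \<le> 2" for u using \<mu>[of b] c[of b u] by linarith+
    have s: "(\<Sum>u\<in>S. \<mu> b - c b u) = 0" "(\<Sum>u\<in>S. c b u - \<mu> b) = 0" by (simp_all add: sum_subtractf \<mu>S)
    show "real (card (W b)) \<le> e" unfolding W_def e_def by (rule card_samples_deviating_le[OF S(1) s(1) d(1)])
    show "real (card (V b)) \<le> e" unfolding V_def e_def by (rule card_samples_deviating_le[OF S(1) s(2) d(2)])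
  qed
  let ?P = "{..<m} \<rightarrow>\<^sub>E S"
  have finP: "finite ?P" using S by (intro finite_PiE) auto
  have "card (\<Union>b\<in>B. W b \<union> V b) < card ?P"
  proof -
    have "real (card (\<Union>b\<in>B. W b \<union> V b)) \<le> real (\<Sum>b\<in>B. card (W b \<union> V b))"
      using card_UN_le[OF B] by (simp only: of_nat_le_iff)
    also have "\<dots> \<le> (\<Sum>b\<in>B. 2 * e)"
      unfolding of_nat_sum
    proof (rule sum_mono)
      fix b
      have "real (card (W b \<union> V b)) \<le> real (card (W b) + card (V b))" by (simp only: of_nat_le_iff card_Un_le)
      then show "real (card (W b \<union> V b)) \<le> 2 * e" using WV[of b] by simp
    qed
    also have "\<dots> = (2 * card B * exp (- m / 256)) * real (card S) ^ m" by (simp add: e_def)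
    also have "\<dots> < 1 * real (card S) ^ m" using m cS by (intro mult_strict_right_mono) auto
    also have "\<dots> = real (card ?P)" by (simp add: card_PiE)
    finally show ?thesis by simp
  qed
  moreover have "finite (\<Union>b\<in>B. W b \<union> V b)"
    by (rule finite_subset[OF _ finP]) (auto simp: W_def V_def)
  ultimately have "\<not> ?P \<subseteq> (\<Union>b\<in>B. W b \<union> V b)"
    using card_mono by (metis linorder_not_le)
  then obtain us where us: "us \<in> ?P" "\<And>b. b \<in> B \<Longrightarrow> us \<notin> W b \<and> us \<notin> V b" by blast
  have dev: "(\<Sum>l<m. c b (us l)) > m * \<mu> b - m / 4" "(\<Sum>l<m. c b (us l)) < m * \<mu> b + m / 4" if "b \<in> B" for b
    using us(2)[OF that] us(1) by (auto simp: W_def V_def sum_subtractf)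
  show thesis
  proof (rule that[OF us(1)])
    fix b assume b: "b \<in> B" and "3 / 4 * card S \<le> (\<Sum>u\<in>S. c b u)"
    then have "3 / 4 \<le> \<mu> b" using cS by (simp add: \<mu>_def le_divide_eq)
    then have "m * (3 / 4) \<le> m * \<mu> b" by (intro mult_left_mono) auto
    then show "m / 2 \<le> (\<Sum>l<m. c b (us l))" using dev(1)[OF b] by simp
  next
    fix b assume b: "b \<in> B" and "m / 2 \<le> (\<Sum>l<m. c b (us l))"
    then have "m * (1 / 4) < m * \<mu> b" using dev(2)[OF b] by simp
    then have "1 / 4 \<le> \<mu> b" using mult_left_mono[of "\<mu> b" "1 / 4" "real m"] by linarith
    then show "card S / 4 \<le> (\<Sum>u\<in>S. c b u)" using cS by (simp add: \<mu>_def le_divide_eq)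
  qed
qed

text \<open>This depends on the sample \<open>us\<close> alone and not on the frequency set it was
  drawn from. There are therefore no more spectra than samples, which makes the union bound
  affordable.\<close>

definition spectrum :: "nat \<Rightarrow> nat \<Rightarrow> nat \<Rightarrow> (nat \<Rightarrow> int) \<Rightarrow> int set" where
  "spectrum G H m us =
     {b \<in> {- int H..int H}. real m / 2 \<le> (\<Sum>l<m. cos (2 * pi * (of_int (us l) / (64 * real G)) * of_int b))}"

text \<open>Richness yields many low-energy frequencies \<open>A\<close>; translation enlarges them
  to \<open>S\<close>, of size at least \<open>k * \<rho> * G / 4\<close>, from which the sample is
  drawn. Parseval bounds the spectrum from above, and averaging the energy over \<open>S\<close>
  shows that few coordinates round outside it.\<close>

lemma rich_imp_structured:
  fixes x :: "'i \<Rightarrow> real" and G k H m :: nat and M c v \<tau> \<rho> E :: real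
  assumes I: "finite I" and G: "0 < G" and k: "0 < k" and \<rho>: "0 < \<rho>"
    and rich: "\<rho> \<le> measure_pmf.prob (signs I) {\<xi>. \<bar>(\<Sum>i\<in>I. \<xi> i * x i) - z\<bar> \<le> 1}"
    and M: "8 * exp (- M / 2) \<le> \<rho>"
    and v: "0 < v" "v \<le> \<tau>" and c: "0 < c" "c \<le> 1"
    and \<tau>: "64 \<le> \<tau>" and G': "2 * pi * k * \<tau> \<le> c * (64 * real G)"
    and many: "4 * M < card {i\<in>I. v < \<bar>x i\<bar> \<and> \<bar>x i\<bar> \<le> \<tau>} * ((c * v / (2 * k * \<tau>))\<^sup>2 / 4)"
    and E: "2 * M + 2 * (card {i\<in>I. \<tau> < \<bar>x i\<bar>} + card I * c\<^sup>2) \<le> E"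
    and H: "\<And>i. i \<in> I \<Longrightarrow> \<bar>x i\<bar> + 1 \<le> real H" "H < 32 * G"
    and m: "2 * (2 * real H + 1) * exp (- m / 256) < 1"
  obtains us where "us \<in> {..<m} \<rightarrow>\<^sub>E {- int (2 * G)<..<int (2 * G)}"
    "card {i\<in>I. round (x i) \<notin> spectrum G H m us} \<le> 64 * E"
    "card (spectrum G H m us) * (k * \<rho>) \<le> 4096"
proof -
  define A where "A = {u \<in> {- int G<..<int G}. energy I x (of_int u / (64 * real G)) \<le> M}"
  define S where "S = {u \<in> {- int (2 * G)<..<int (2 * G)}. energy I x (of_int u / (64 * real G)) \<le> E}"
  have finS: "finite S" unfolding S_def by (rule finite_subset[of _ "{- int (2 * G)<..<int (2 * G)}"]) auto
  have "\<rho> \<le> 2 * (card A / G + exp (- M / 2))"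
    using rich small_ball_low_energy[OF I G, of x z M] unfolding A_def by (rule order_trans)
  then have "\<rho> / 4 \<le> card A / G" using M \<rho> by (simp add: field_simps)
  then have cA: "\<rho> * G / 4 \<le> card A" using G by (simp add: field_simps)
  have "k * card A \<le> card S"
  proof -
    have "k * card A \<le> card {u \<in> {- int (2 * G)<..<int (2 * G)}. energy I x (of_int u / (64 * real G))
        \<le> 2 * M + 2 * (card {i\<in>I. \<tau> < \<bar>x i\<bar>} + card I * c\<^sup>2)}"
      unfolding A_def by (rule card_low_energy_gain) fact+
    also have "\<dots> \<le> card S"
      using E by (intro card_mono finS) (auto simp: S_def)
    finally show ?thesis .
  qed
  then have "real k * real (card A) \<le> card S" by (simp only: of_nat_le_iff of_nat_mult[symmetric])
  moreover have "k * (\<rho> * G / 4) \<le> k * real (card A)" using cA by (intro mult_left_mono) auto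
  ultimately have cS: "k * \<rho> * G / 4 \<le> card S" by simp
  have "0 < k * \<rho> * G / 4" using k \<rho> G by simp
  then have cS0: "0 < card S" using cS by linarith
  then have S0: "S \<noteq> {}" by auto
  define w where "w b u = cos (2 * pi * (of_int u / (64 * real G)) * of_int b)" for b u :: int
  obtain us where us: "us \<in> {..<m} \<rightarrow>\<^sub>E S"
    "\<And>b. b \<in> {- int H..int H} \<Longrightarrow> 3 / 4 * card S \<le> (\<Sum>u\<in>S. w b u) \<Longrightarrow> m / 2 \<le> (\<Sum>l<m. w b (us l))"
    "\<And>b. b \<in> {- int H..int H} \<Longrightarrow> m / 2 \<le> (\<Sum>l<m. w b (us l)) \<Longrightarrow> card S / 4 \<le> (\<Sum>u\<in>S. w b u)"
  proof (rule exists_good_sample[OF finS S0, of "{- int H..int H}" w m])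
    show "2 * real (card {- int H..int H}) * exp (- m / 256) < 1"
      using m by (simp add: nat_add_distrib add.commute)
  qed (auto simp: w_def)
  let ?Y = "spectrum G H m us"
  show thesis
  proof (rule that)
    show "us \<in> {..<m} \<rightarrow>\<^sub>E {- int (2 * G)<..<int (2 * G)}"
      using us(1) by (rule PiE_mono[THEN subsetD, rotated]) (auto simp: S_def)
    \<comment> \<open>The denominator \<open>64 * G\<close> is \<open>2 * P\<close> for
      \<open>P = 32 * G\<close>. With the lower bound on \<open>card S\<close> this gives the
      constant \<open>32 * 32 * 4 = 4096\<close>.\<close>
    have "real (card ?Y) * real (card S) \<le> 32 * real (32 * G)"
    proof (rule card_large_spectrum_le[OF finS S0])
      show "\<bar>u - v\<bar> < 2 * int (32 * G)" if "u \<in> S" "v \<in> S" for u v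
        using that by (auto simp: S_def)
      show "?Y \<subseteq> {- int (32 * G)..<int (32 * G)}" using H(2) by (auto simp: spectrum_def)
      show "card S / 4 \<le> (\<Sum>u\<in>S. cos (2 * pi * (of_int u / (2 * real (32 * G))) * of_int b))" if "b \<in> ?Y" for b
        using us(3)[of b] that by (simp add: spectrum_def w_def)
    qed
    moreover have "card ?Y * (k * \<rho> * G / 4) \<le> real (card ?Y) * real (card S)"
      using cS by (intro mult_left_mono) auto
    ultimately have "(card ?Y * (k * \<rho>)) * real G \<le> 4096 * real G" by simp
    then show "card ?Y * (k * \<rho>) \<le> 4096" using G by (subst (asm) mult_le_cancel_right) auto
    \<comment> \<open>\<open>g i / card S\<close> is the mean squared sine at coordinate
      \<open>i\<close> over \<open>S\<close>. By Markov's inequality it exceeds 1/64 for at most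
      \<open>64 * E\<close> coordinates.\<close>
    define g where "g i = (\<Sum>u\<in>S. (sin (pi * (of_int u / (64 * real G)) * x i))\<^sup>2)" for i
    have good: "round (x i) \<in> ?Y" if i: "i \<in> I" and gi: "g i \<le> card S / 64" for i
    proof -
      let ?a = "round (x i)"
      have ra: "\<bar>of_int ?a - x i\<bar> \<le> 1 / 2" by (rule of_int_round_abs_le)
      then have "\<bar>of_int ?a\<bar> \<le> real H" using H(1)[OF i] by linarith
      then have aH: "?a \<in> {- int H..int H}" by (simp add: abs_le_iff)
      \<comment> \<open>Rounding moves the angle by at most 1/16, because
        \<open>\<bar>u\<bar> \<le> 2 * G\<close>. By
        \<open>cos (2 * y) = 1 - 2 * (sin y)\<^sup>2\<close> the loss per frequency is 1/64 plus
        four squared sines, on average at most 5/64.\<close>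
      have "3 / 4 * card S \<le> (\<Sum>u\<in>S. w ?a u)"
      proof -
        have "3 / 4 * card S \<le> (1 - 1/64) * card S - 4 * g i" using gi by simp
        also have "\<dots> = (\<Sum>u\<in>S. (1 - 1 / 64) - 4 * (sin (pi * (of_int u / (64 * real G)) * x i))\<^sup>2)"
          by (simp add: g_def sum_subtractf sum_distrib_left)
        also have "\<dots> \<le> (\<Sum>u\<in>S. w ?a u)"
        proof (rule sum_mono)
          fix u assume u: "u \<in> S"
          let ?t = "of_int u / (64 * real G)"
          have "\<bar>of_int u\<bar> \<le> 2 * real G" using u unfolding S_def by auto
          then have t: "\<bar>?t\<bar> \<le> 1 / 32" using G by (simp add: abs_divide field_simps)
          have "\<bar>pi * ?t * (of_int ?a - x i)\<bar> = pi * \<bar>?t\<bar> * \<bar>of_int ?a - x i\<bar>" by (simp only: abs_mult) simp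
          also have "\<dots> \<le> 4 * (1 / 32) * (1 / 2)"
            using ra t pi_less_4 by (intro mult_mono) auto
          finally have "\<bar>pi * ?t * (of_int ?a - x i)\<bar> \<le> \<bar>1 / 16\<bar>" by simp
          then have "(pi * ?t * (of_int ?a - x i))\<^sup>2 \<le> (1 / 16)\<^sup>2" by (simp only: abs_le_square_iff)
          then have s2: "(sin (pi * ?t * (of_int ?a - x i)))\<^sup>2 \<le> 1 / 256"
            using sin_squared_le[of "pi * ?t * (of_int ?a - x i)"] by (simp add: power_divide)
          have "pi * ?t * of_int ?a = pi * ?t * x i + pi * ?t * (of_int ?a - x i)" by (simp add: right_diff_distrib)
          then have "(sin (pi * ?t * of_int ?a))\<^sup>2 \<le> 2 * (sin (pi * ?t * x i))\<^sup>2 + 2 * (sin (pi * ?t * (of_int ?a - x i)))\<^sup>2"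
            by (simp only: sin_add_squared_le)
          then have *: "(sin (pi * ?t * of_int ?a))\<^sup>2 \<le> 2 * (sin (pi * ?t * x i))\<^sup>2 + 1 / 128" using s2 by simp
          have "w ?a u = cos (2 * (pi * ?t * of_int ?a))" by (simp add: w_def mult_ac)
          also have "\<dots> = 1 - 2 * (sin (pi * ?t * of_int ?a))\<^sup>2" by (simp only: cos_double_sin)
          finally show "(1 - 1 / 64) - 4 * (sin (pi * ?t * x i))\<^sup>2 \<le> w ?a u" using * by simp
        qed
        finally show ?thesis .
      qed
      then have "m / 2 \<le> (\<Sum>l<m. w ?a (us l))" by (rule us(2)[OF aH])
      then show ?thesis using aH by (simp add: spectrum_def w_def)
    qed
    let ?D = "{i\<in>I. round (x i) \<notin> ?Y}"
    have "card ?D * (card S / 64) = (\<Sum>i\<in>?D. card S / 64)" by simp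
    also have "\<dots> \<le> (\<Sum>i\<in>?D. g i)" 
    proof (rule sum_mono)
      fix i assume "i \<in> ?D"
      then show "card S / 64 \<le> g i" using good[of i] by (cases "g i \<le> card S / 64") auto
    qed
    also have "\<dots> \<le> (\<Sum>i\<in>I. g i)" using I by (intro sum_mono2) (auto simp: g_def intro: sum_nonneg)
    also have "\<dots> = (\<Sum>u\<in>S. energy I x (of_int u / (64 * real G)))"
      unfolding g_def energy_def by (rule sum.swap)
    also have "\<dots> \<le> (\<Sum>u\<in>S. E)" by (intro sum_mono) (auto simp: S_def)
    also have "\<dots> = (64 * E) * (card S / 64)" by simp
    finally show "card ?D \<le> 64 * E" using cS0 by (subst (asm) mult_le_cancel_right) auto
  qed
qed

section \<open>Counting and independent rows\<close>

text \<open>A set of at most \<open>t\<close> elements can be read off \<open>t\<close> slots, each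
  holding an element or \<open>None\<close> if it is empty.\<close>

lemma card_small_subsets_le:
  assumes "finite I"
  shows "card {E. E \<subseteq> I \<and> card E \<le> t} \<le> (card I + 1) ^ t"
proof -
  let ?F = "{..<t} \<rightarrow>\<^sub>E insert None (Some ` I)"
  have finF: "finite ?F" using assms by (intro finite_PiE) auto
  have "{E. E \<subseteq> I \<and> card E \<le> t} \<subseteq> (\<lambda>f. {y. Some y \<in> f ` {..<t}}) ` ?F"
  proof clarify
    fix E assume E: "E \<subseteq> I" "card E \<le> t"
    then have "finite E" using assms finite_subset by blast
    then obtain h where h: "bij_betw h {0..<card E} E" using ex_bij_betw_nat_finite by blast
    define f where "f = restrict (\<lambda>j. if j < card E then Some (h j) else None) {..<t}"
    have hE: "h ` {0..<card E} = E" using h by (simp add: bij_betw_def)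
    have hI: "h j \<in> I" if "j < card E" for j using hE E(1) that by force
    have "f \<in> ?F" using hI by (auto simp: f_def)
    moreover have "E = {y. Some y \<in> f ` {..<t}}"
    proof (intro subset_antisym subsetI)
      fix y assume "y \<in> E"
      then obtain j where "j < card E" "y = h j" using hE by force
      then show "y \<in> {y. Some y \<in> f ` {..<t}}" using E by (auto simp: f_def image_iff intro!: bexI[of _ j])
    next
      fix y assume "y \<in> {y. Some y \<in> f ` {..<t}}"
      then obtain j where "j < t" "Some y = f j" by auto
      then have "j < card E" "y = h j" by (auto simp: f_def split: if_splits)
      then show "y \<in> E" using hE by auto
    qed
    ultimately show "E \<in> (\<lambda>f. {y. Some y \<in> f ` {..<t}}) ` ?F" by blast
  qed
  then have "card {E. E \<subseteq> I \<and> card E \<le> t} \<le> card ?F"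
    using finF by (rule surj_card_le[rotated])
  also have "\<dots> = (card I + 1) ^ t"
    using assms by (simp add: card_PiE card_insert_if card_image)
  finally show ?thesis .
qed

text \<open>First the exceptional positions are chosen, then values in \<open>B\<close> there and in
  \<open>Y\<close> elsewhere. As \<open>Y\<close> is nonempty, the exponent of \<open>card Y\<close>
  may be raised to \<open>card I\<close>.\<close>

lemma card_mostly_in_le:
  assumes I: "finite I" and B: "finite B" "Y \<subseteq> B" and Y: "Y \<noteq> {}"
  shows "card {a \<in> I \<rightarrow>\<^sub>E B. card {i\<in>I. a i \<notin> Y} \<le> t} \<le> ((card I + 1) * card B) ^ t * card Y ^ card I"
proof -
  let ?Es = "{E. E \<subseteq> I \<and> card E \<le> t}"
  have fY: "finite Y" using B finite_subset by blast
  have pos: "1 \<le> card Y" "1 \<le> card B" using fY Y B by (auto simp: Suc_le_eq card_gt_0_iff)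
  have fEs: "finite ?Es" by (rule finite_subset[of _ "Pow I"]) (use I in auto)
  have "{a \<in> I \<rightarrow>\<^sub>E B. card {i\<in>I. a i \<notin> Y} \<le> t} \<subseteq> (\<Union>E\<in>?Es. PiE I (\<lambda>i. if i \<in> E then B else Y))"
  proof
    fix a assume a: "a \<in> {a \<in> I \<rightarrow>\<^sub>E B. card {i\<in>I. a i \<notin> Y} \<le> t}"
    then show "a \<in> (\<Union>E\<in>?Es. PiE I (\<lambda>i. if i \<in> E then B else Y))"
      by (intro UN_I[of "{i\<in>I. a i \<notin> Y}"]) (auto simp: PiE_iff)
  qed
  then have "card {a \<in> I \<rightarrow>\<^sub>E B. card {i\<in>I. a i \<notin> Y} \<le> t} \<le> card (\<Union>E\<in>?Es. PiE I (\<lambda>i. if i \<in> E then B else Y))"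
    using fEs I B fY by (intro card_mono finite_UN_I finite_PiE) auto
  also have "\<dots> \<le> (\<Sum>E\<in>?Es. card (PiE I (\<lambda>i. if i \<in> E then B else Y)))"
    by (rule card_UN_le[OF fEs])
  also have "\<dots> \<le> (\<Sum>E\<in>?Es. card B ^ t * card Y ^ card I)"
  proof (rule sum_mono)
    fix E assume E: "E \<in> ?Es"
    have "card (PiE I (\<lambda>i. if i \<in> E then B else Y)) = (\<Prod>i\<in>I. if i \<in> E then card B else card Y)"
      using I by (simp add: card_PiE if_distrib)
    also have "\<dots> = card B ^ card (I \<inter> E) * card Y ^ card (I \<inter> - E)"
      using I by (simp add: prod.If_cases)
    also have "I \<inter> E = E" using E by auto
    also have "card B ^ card E * card Y ^ card (I \<inter> - E) \<le> card B ^ t * card Y ^ card I"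
      using E pos I by (intro mult_mono power_increasing card_mono) auto
    finally show "card (PiE I (\<lambda>i. if i \<in> E then B else Y)) \<le> card B ^ t * card Y ^ card I" .
  qed
  also have "\<dots> = card ?Es * (card B ^ t * card Y ^ card I)" by simp
  also have "\<dots> \<le> (card I + 1) ^ t * (card B ^ t * card Y ^ card I)"
    by (intro mult_right_mono card_small_subsets_le I) auto
  finally show ?thesis by (simp only: power_mult_distrib mult.assoc)
qed

section \<open>Independence of the rows\<close>

text \<open>Fubini for independent blocks: the signs on \<open>A\<close> are averaged while those on
  \<open>B\<close> are held fixed.\<close>

lemma prob_signs_Un:
  assumes "finite A" "finite B" "A \<inter> B = {}"
  shows "measure_pmf.prob (signs (A \<union> B)) S =
    measure_pmf.expectation (signs B) (\<lambda>g. measure_pmf.prob (signs A) {f. (\<lambda>x. if x \<in> A then f x else g x) \<in> S})"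
proof -
  have "signs (A \<union> B) = bind_pmf (signs B) (\<lambda>g. map_pmf (\<lambda>f x. if x \<in> A then f x else g x) (signs A))"
    using assms by (simp add: signs_def Pi_pmf_union pair_pmf_def map_bind_pmf bind_commute_pmf[of "Pi_pmf A _ _"])
       (simp add: map_pmf_def bind_assoc_pmf bind_return_pmf)
  then have "measure_pmf.prob (signs (A \<union> B)) S = measure_pmf.expectation
      (bind_pmf (signs B) (\<lambda>g. map_pmf (\<lambda>f x. if x \<in> A then f x else g x) (signs A))) (indicat_real S)"
    by simp
  also have "\<dots> = (\<Sum>g\<in>set_pmf (signs B). pmf (signs B) g *\<^sub>R
      measure_pmf.expectation (map_pmf (\<lambda>f x. if x \<in> A then f x else g x) (signs A)) (indicat_real S))"
    using assms by (intro pmf_expectation_bind) (auto simp: finite_set_signs)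
  also have "\<dots> = measure_pmf.expectation (signs B)
      (\<lambda>g. measure_pmf.expectation (map_pmf (\<lambda>f x. if x \<in> A then f x else g x) (signs A)) (indicat_real S))"
    using assms by (subst integral_measure_pmf[where A = "set_pmf (signs B)"]) (auto simp: finite_set_signs)
  also have "\<dots> = measure_pmf.expectation (signs B) (\<lambda>g. measure_pmf.prob (signs A) {f. (\<lambda>x. if x \<in> A then f x else g x) \<in> S})"
    by (simp add: vimage_def)
  finally show ?thesis .
qed

lemma prob_signs_row:
  assumes "finite J"
  shows "measure_pmf.prob (signs ({k} \<times> J)) {f. (\<lambda>j. f (k, j)) \<in> S} = measure_pmf.prob (signs J) S"
proof -
  have "signs J = map_pmf (\<lambda>g. g \<circ> Pair k) (signs ({k} \<times> J))"
    unfolding signs_def using assms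
    by (intro Pi_pmf_bij_betw) (auto simp: bij_betw_def inj_on_def)
  then show ?thesis by (simp add: vimage_def o_def)
qed

text \<open>Rows are split off one at a time by the block formula. Glueing takes the values outside
  \<open>J\<close> from the other block, so \<open>dep\<close> is what makes the event of a row a
  condition on that row alone.\<close>

lemma prob_signs_rows_le:
  fixes p :: "'k \<Rightarrow> real"
  assumes "finite K" "finite J" "\<And>i. i \<in> K \<Longrightarrow> measure_pmf.prob (signs J) (S i) \<le> p i"
    and dep: "\<And>i \<xi> \<xi>'. (\<And>j. j \<in> J \<Longrightarrow> \<xi> j = \<xi>' j) \<Longrightarrow> \<xi> \<in> S i \<Longrightarrow> \<xi>' \<in> S i"
  shows "measure_pmf.prob (signs (K \<times> J)) {f. \<forall>i\<in>K. (\<lambda>j. f (i, j)) \<in> S i} \<le> (\<Prod>i\<in>K. p i)"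
  using assms(1,3)
proof (induction K rule: finite_induct)
  case (insert k K)
  let ?Q = "{g. \<forall>i\<in>K. (\<lambda>j. g (i, j)) \<in> S i}"
  let ?R = "{f. \<forall>i\<in>insert k K. (\<lambda>j. f (i, j)) \<in> S i}"
  have p0: "0 \<le> p k" using insert.prems[of k] measure_nonneg order_trans by blast
  have "insert k K \<times> J = ({k} \<times> J) \<union> (K \<times> J)" by auto
  then have "measure_pmf.prob (signs (insert k K \<times> J)) ?R =
    measure_pmf.expectation (signs (K \<times> J)) (\<lambda>g. measure_pmf.prob (signs ({k} \<times> J))
      {f. (\<lambda>x. if x \<in> {k} \<times> J then f x else g x) \<in> ?R})"
    using insert.hyps assms(2) by (simp only:) (rule prob_signs_Un, auto)
  also have "\<dots> \<le> measure_pmf.expectation (signs (K \<times> J)) (\<lambda>g. p k * indicat_real ?Q g)"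
  proof (rule integral_mono)
    fix g
    show "measure_pmf.prob (signs ({k} \<times> J))
      {f. (\<lambda>x. if x \<in> {k} \<times> J then f x else g x) \<in> ?R} \<le> p k * indicat_real ?Q g"
    proof (cases "g \<in> ?Q")
      case True
      have "{f. (\<lambda>x. if x \<in> {k} \<times> J then f x else g x) \<in> ?R} \<subseteq> {f. (\<lambda>j. f (k, j)) \<in> S k}"
        by (auto elim: dep[rotated])
      then have "measure_pmf.prob (signs ({k} \<times> J))
          {f. (\<lambda>x. if x \<in> {k} \<times> J then f x else g x) \<in> ?R}
          \<le> measure_pmf.prob (signs ({k} \<times> J)) {f. (\<lambda>j. f (k, j)) \<in> S k}"
        by (intro measure_pmf.finite_measure_mono) auto
      also have "\<dots> \<le> p k" using insert.prems[of k] by (simp add: prob_signs_row assms(2))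
      finally show ?thesis using True by simp
    next
      case False
      then obtain i where i: "i \<in> K" "(\<lambda>j. g (i, j)) \<notin> S i" by auto
      have "i \<noteq> k" using i insert.hyps by auto
      then have "{f. (\<lambda>x. if x \<in> {k} \<times> J then f x else g x) \<in> ?R} = {}"
        using i by (auto intro!: bexI[of _ i])
      then show ?thesis using p0 by (simp only:) simp
    qed
  qed (use insert.hyps assms(2) in \<open>auto intro!: integrable_signs\<close>)
  also have "\<dots> = p k * measure_pmf.prob (signs (K \<times> J)) ?Q" by simp
  also have "\<dots> \<le> p k * (\<Prod>i\<in>K. p i)" using insert p0 by (intro mult_left_mono) auto
  finally show ?case using insert.hyps by simp
qed simp

text \<open>Union bound over \<open>V\<close>: for a fixed \<open>a\<close> the rows are
  independent, and the deterministic part \<open>R\<close> is absorbed into the centre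
  \<open>z\<close>.\<close>

lemma prob_exists_small_image_le:
  fixes R :: "nat \<Rightarrow> nat \<Rightarrow> real" and V :: "(nat \<Rightarrow> int) set" and p L :: real
  assumes V: "finite V" and k: "k < n"
    and p: "\<And>a z. a \<in> V \<Longrightarrow> measure_pmf.prob (signs {..<n}) {\<xi>. \<bar>(\<Sum>j<n. \<xi> j * of_int (a j)) - z\<bar> \<le> L} \<le> p"
  shows "measure_pmf.prob (signs ({..<n} \<times> {..<n}))
      {f. \<exists>a\<in>V. \<forall>i<n. i \<noteq> k \<longrightarrow> \<bar>\<Sum>j<n. (R i j + f (i, j)) * of_int (a j)\<bar> \<le> L} \<le> card V * p ^ (n - 1)"
proof -
  have one: "measure_pmf.prob (signs ({..<n} \<times> {..<n}))
      {f. \<forall>i<n. i \<noteq> k \<longrightarrow> \<bar>\<Sum>j<n. (R i j + f (i, j)) * of_int (a j)\<bar> \<le> L} \<le> p ^ (n - 1)" if a: "a \<in> V" for a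
  proof -
    \<comment> \<open>Row \<open>k\<close> gets the sure event and the factor 1, hence the exponent
      \<open>n - 1\<close>.\<close>
    define S where "S i = (if i = k then UNIV else {\<xi>. \<bar>\<Sum>j<n. (R i j + \<xi> j) * of_int (a j)\<bar> \<le> L})" for i
    have "{f. \<forall>i<n. i \<noteq> k \<longrightarrow> \<bar>\<Sum>j<n. (R i j + f (i, j)) * of_int (a j)\<bar> \<le> L} =
        {f. \<forall>i\<in>{..<n}. (\<lambda>j. f (i, j)) \<in> S i}"
      by (auto simp: S_def)
    moreover have "measure_pmf.prob (signs ({..<n} \<times> {..<n})) {f. \<forall>i\<in>{..<n}. (\<lambda>j. f (i, j)) \<in> S i}
       \<le> (\<Prod>i<n. if i = k then 1 else p :: real)"
    proof (rule prob_signs_rows_le)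
      fix i assume "i \<in> {..<n}"
      have "{\<xi>. \<bar>\<Sum>j<n. (R i j + \<xi> j) * of_int (a j)\<bar> \<le> L} =
        {\<xi>. \<bar>(\<Sum>j<n. \<xi> j * of_int (a j)) - (- (\<Sum>j<n. R i j * of_int (a j)))\<bar> \<le> L}"
        by (simp add: distrib_right sum.distrib add.commute)
      then show "measure_pmf.prob (signs {..<n}) (S i) \<le> (if i = k then 1 else p)"
        unfolding S_def using p[OF a, of "- (\<Sum>j<n. R i j * of_int (a j))"] by simp
    next
      fix i and \<xi> \<xi>' :: "nat \<Rightarrow> real"
      assume eq: "\<And>j. j \<in> {..<n} \<Longrightarrow> \<xi> j = \<xi>' j" and "\<xi> \<in> S i"
      moreover have "(\<Sum>j<n. (R i j + \<xi> j) * of_int (a j)) = (\<Sum>j<n. (R i j + \<xi>' j) * of_int (a j))"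
        using eq by (intro sum.cong) auto
      ultimately show "\<xi>' \<in> S i" by (auto simp: S_def split: if_splits)
    qed auto
    moreover have "(\<Prod>i<n. if i = k then 1 else p :: real) = p ^ (n - 1)"
    proof -
      have "(\<Prod>i<n. if i = k then 1 else p :: real) = (\<Prod>i\<in>{..<n} - {k}. p)"
        using k by (subst prod.remove[of _ k]) auto
      then show ?thesis using k by simp
    qed
    ultimately show ?thesis by simp
  qed
  have "{f. \<exists>a\<in>V. \<forall>i<n. i \<noteq> k \<longrightarrow> \<bar>\<Sum>j<n. (R i j + f (i, j)) * of_int (a j)\<bar> \<le> L} =
    (\<Union>a\<in>V. {f. \<forall>i<n. i \<noteq> k \<longrightarrow> \<bar>\<Sum>j<n. (R i j + f (i, j)) * of_int (a j)\<bar> \<le> L})" by auto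
  then have "measure_pmf.prob (signs ({..<n} \<times> {..<n}))
      {f. \<exists>a\<in>V. \<forall>i<n. i \<noteq> k \<longrightarrow> \<bar>\<Sum>j<n. (R i j + f (i, j)) * of_int (a j)\<bar> \<le> L}
    \<le> (\<Sum>a\<in>V. measure_pmf.prob (signs ({..<n} \<times> {..<n}))
      {f. \<forall>i<n. i \<noteq> k \<longrightarrow> \<bar>\<Sum>j<n. (R i j + f (i, j)) * of_int (a j)\<bar> \<le> L})"
    by (simp only:) (rule measure_pmf.finite_measure_subadditive_finite[OF V], auto)
  also have "\<dots> \<le> (\<Sum>a\<in>V. p ^ (n - 1))" by (intro sum_mono one)
  finally show ?thesis by simp
qed

text \<open>The vector \<open>x\<close> can be chosen as a function of the rows other than \<open>k\<close>, hence
  independently of row \<open>k\<close>.\<close>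
lemma prob_row_near_normal_le:
  fixes R :: "nat \<Rightarrow> nat \<Rightarrow> real" and P U :: "(nat \<Rightarrow> real) \<Rightarrow> bool" and p \<epsilon> :: real
  assumes k: "k < n" and U: "\<And>x. P x \<Longrightarrow> U x"
    and p: "\<And>x z. P x \<Longrightarrow> measure_pmf.prob (signs {..<n}) {\<xi>. \<bar>(\<Sum>j<n. \<xi> j * x j) - z\<bar> \<le> \<epsilon>} \<le> p" and "0 \<le> p"
  shows "measure_pmf.prob (signs ({..<n} \<times> {..<n}))
      {f. (\<exists>x. P x \<and> (\<forall>i<n. i \<noteq> k \<longrightarrow> (\<Sum>j<n. (R i j + f (i, j)) * x j) = 0)) \<and>
          (\<forall>x. U x \<longrightarrow> (\<forall>i<n. i \<noteq> k \<longrightarrow> (\<Sum>j<n. (R i j + f (i, j)) * x j) = 0) \<longrightarrow>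
             \<bar>\<Sum>j<n. (R k j + f (k, j)) * x j\<bar> \<le> \<epsilon>)} \<le> p"
    (is "measure_pmf.prob _ ?E \<le> p")
proof -
  let ?A = "{k} \<times> {..<n}" and ?B = "({..<n} - {k}) \<times> {..<n}"
  have "{..<n} \<times> {..<n} = ?A \<union> ?B" using k by auto
  then have "measure_pmf.prob (signs ({..<n} \<times> {..<n})) ?E =
    measure_pmf.expectation (signs ?B) (\<lambda>g. measure_pmf.prob (signs ?A) {f. (\<lambda>x. if x \<in> ?A then f x else g x) \<in> ?E})"
    by (simp only:) (rule prob_signs_Un, auto)
  also have "\<dots> \<le> measure_pmf.expectation (signs ?B) (\<lambda>g. p)"
  proof (rule integral_mono)
    fix g :: "nat \<times> nat \<Rightarrow> real"
    let ?h = "\<lambda>f x. if x \<in> ?A then f x else g x"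
    show "measure_pmf.prob (signs ?A) {f. ?h f \<in> ?E} \<le> p"
    proof (cases "\<exists>x. P x \<and> (\<forall>i<n. i \<noteq> k \<longrightarrow> (\<Sum>j<n. (R i j + g (i, j)) * x j) = 0)")
      case False
      then have "{f. ?h f \<in> ?E} = {}" by (auto cong: sum.cong)
      then show ?thesis using \<open>0 \<le> p\<close> by (simp only:) simp
    next
      case True
      then obtain x where x: "P x" "\<And>i. i < n \<Longrightarrow> i \<noteq> k \<Longrightarrow> (\<Sum>j<n. (R i j + g (i, j)) * x j) = 0" by blast
      have "{f. ?h f \<in> ?E} \<subseteq> {f. (\<lambda>j. f (k, j)) \<in> {\<xi>. \<bar>(\<Sum>j<n. \<xi> j * x j) - (- (\<Sum>j<n. R k j * x j))\<bar> \<le> \<epsilon>}}"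
      proof
        fix f assume f: "f \<in> {f. ?h f \<in> ?E}"
        have "(\<Sum>j<n. (R i j + ?h f (i, j)) * x j) = 0" if "i < n" "i \<noteq> k" for i
          using x(2)[OF that] that by simp
        then have "\<bar>\<Sum>j<n. (R k j + ?h f (k, j)) * x j\<bar> \<le> \<epsilon>"
          using f U[OF x(1)] by blast
        also have "(\<Sum>j<n. (R k j + ?h f (k, j)) * x j) = (\<Sum>j<n. f (k, j) * x j) - (- (\<Sum>j<n. R k j * x j))"
          by (simp add: distrib_right sum.distrib)
        finally show "f \<in> {f. (\<lambda>j. f (k, j)) \<in> {\<xi>. \<bar>(\<Sum>j<n. \<xi> j * x j) - (- (\<Sum>j<n. R k j * x j))\<bar> \<le> \<epsilon>}}"
          by simp
      qed
      then have "measure_pmf.prob (signs ?A) {f. ?h f \<in> ?E} \<le>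
        measure_pmf.prob (signs ?A) {f. (\<lambda>j. f (k, j)) \<in> {\<xi>. \<bar>(\<Sum>j<n. \<xi> j * x j) - (- (\<Sum>j<n. R k j * x j))\<bar> \<le> \<epsilon>}}"
        by (intro measure_pmf.finite_measure_mono) auto
      also have "\<dots> \<le> p" unfolding prob_signs_row[OF finite_lessThan] by (rule p[OF x(1)])
      finally show ?thesis .
    qed
  qed (auto intro!: integrable_signs)
  finally show ?thesis by simp
qed

text \<open>Flipping one sign moves the sum by more than the length of the window.\<close>
lemma prob_small_ball_le_half:
  fixes x :: "'i \<Rightarrow> real" and L :: real
  assumes I: "finite I" and a: "a \<in> I" "L < \<bar>x a\<bar>"
  shows "measure_pmf.prob (signs I) {\<xi>. \<bar>(\<Sum>i\<in>I. \<xi> i * x i) - z\<bar> \<le> L} \<le> 1 / 2"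
proof -
  define K where "K = I - {a}"
  have K: "finite K" "a \<notin> K" "I = insert a K" using I a by (auto simp: K_def)
  have upd: "(\<Sum>i\<in>insert a K. (f(a := y)) i * x i) = y * x a + (\<Sum>i\<in>K. f i * x i)" for f y
  proof -
    have "(\<Sum>i\<in>K. (f(a := y)) i * x i) = (\<Sum>i\<in>K. f i * x i)"
      using K by (intro sum.cong) auto
    then show ?thesis using K by simp
  qed
  let ?V = "\<lambda>y. {f. f(a := y) \<in> {\<xi>. \<bar>(\<Sum>i\<in>insert a K. \<xi> i * x i) - z\<bar> \<le> L}}"
  have "?V (-1) \<inter> ?V 1 = {}" using a(2) unfolding mem_Collect_eq upd by auto
  then have "measure_pmf.prob (signs K) (?V (-1)) + measure_pmf.prob (signs K) (?V 1) =
      measure_pmf.prob (signs K) (?V (-1) \<union> ?V 1)"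
    by (intro measure_pmf.finite_measure_Union[symmetric]) auto
  also have "\<dots> \<le> 1" by simp
  finally show ?thesis unfolding K(3) prob_signs_insert[OF K(1,2)] by simp
qed

section \<open>Linear algebra of large condition numbers\<close>

lemma l2_norm_vec: "vec_l2_norm x = sqrt (\<Sum>j<dim_vec x. (x $ j)\<^sup>2)"
  by (simp add: vec_l2_norm_def scalar_prod_def power2_eq_square atLeast0LessThan)

lemma l2_norm_nonneg: "0 \<le> vec_l2_norm x"
  by (simp add: l2_norm_vec sum_nonneg)

lemma abs_component_le_l2_norm: "j < dim_vec x \<Longrightarrow> \<bar>x $ j\<bar> \<le> vec_l2_norm x"
  unfolding l2_norm_vec by (rule real_le_rsqrt) (auto intro: member_le_sum)

lemma l2_norm_le_sum: "vec_l2_norm x \<le> (\<Sum>j<dim_vec x. \<bar>x $ j\<bar>)"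
  unfolding l2_norm_vec using L2_set_le_sum_abs[of "\<lambda>j. x $ j" "{..<dim_vec x}"]
  by (simp add: L2_set_def)

text \<open>Crude, but polynomial losses only change the exponent in the theorem. A unit vector
  shows that the supremum is over a nonempty set, and the entry bound that it is finite.\<close>

lemma sigma1_bounds:
  fixes T :: "real mat"
  assumes T: "T \<in> carrier_mat n n" and n: "0 < n" and b: "\<And>i j. i < n \<Longrightarrow> j < n \<Longrightarrow> \<bar>T $$ (i, j)\<bar> \<le> b"
  shows "0 \<le> sigma1 T" "sigma1 T \<le> (real n)\<^sup>2 * b"
proof -
  let ?U = "{x \<in> carrier_vec (dim_col T). vec_l2_norm x = 1}"
  have "unit_vec n 0 \<in> ?U" using T n by (simp add: vec_l2_norm_def)
  then have ne: "?U \<noteq> {}" by blast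
  have le: "vec_l2_norm (T *\<^sub>v x) \<le> (real n)\<^sup>2 * b" if x: "x \<in> ?U" for x
  proof -
    have xd: "dim_vec x = n" using x T by auto
    have "vec_l2_norm (T *\<^sub>v x) \<le> (\<Sum>i<n. \<bar>(T *\<^sub>v x) $ i\<bar>)"
      using l2_norm_le_sum[of "T *\<^sub>v x"] T by simp
    also have "\<dots> \<le> (\<Sum>i<n. \<Sum>j<n. b)"
    proof (rule sum_mono)
      fix i assume i: "i \<in> {..<n}"
      have "(T *\<^sub>v x) $ i = (\<Sum>j<n. T $$ (i, j) * x $ j)"
        using T xd i by (simp add: scalar_prod_def atLeast0LessThan)
      then have "\<bar>(T *\<^sub>v x) $ i\<bar> \<le> (\<Sum>j<n. \<bar>T $$ (i, j) * x $ j\<bar>)" by (simp only: sum_abs)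
      also have "\<dots> \<le> (\<Sum>j<n. b)"
      proof (rule sum_mono)
        fix j assume j: "j \<in> {..<n}"
        have "\<bar>x $ j\<bar> \<le> 1" using abs_component_le_l2_norm[of j x] x j T by auto
        then have "\<bar>T $$ (i, j)\<bar> * \<bar>x $ j\<bar> \<le> b * 1"
          using b[of i j] i j by (intro mult_mono) auto
        then show "\<bar>T $$ (i, j) * x $ j\<bar> \<le> b" by (simp add: abs_mult)
      qed
      finally show "\<bar>(T *\<^sub>v x) $ i\<bar> \<le> (\<Sum>j<n. b)" .
    qed
    finally show ?thesis by (simp add: power2_eq_square mult.assoc)
  qed
  show "sigma1 T \<le> (real n)\<^sup>2 * b" unfolding sigma1_def by (rule cSUP_least[OF ne le])
  obtain x where x: "x \<in> ?U" using ne by blast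
  have "0 \<le> vec_l2_norm (T *\<^sub>v x)" by (rule l2_norm_nonneg)
  also have "\<dots> \<le> sigma1 T" unfolding sigma1_def
    by (rule cSUP_upper[OF x]) (use le in \<open>auto intro!: bdd_aboveI\<close>)
  finally show "0 \<le> sigma1 T" .
qed

text \<open>If \<open>T\<close> is singular, a nonzero left null vector expresses some row \<open>k\<close> through the others.
  Otherwise let \<open>(i, k)\<close> be the position of the largest entry of the inverse \<open>S\<close>: a vector
  \<open>x\<close> annihilated by all rows but \<open>k\<close> is a multiple of column \<open>k\<close> of \<open>S\<close>.\<close>
lemma cond_number_large_imp_near_normal:
  fixes T :: "real mat"
  assumes T: "T \<in> carrier_mat n n" and n: "0 < n" and b: "\<And>i j. i < n \<Longrightarrow> j < n \<Longrightarrow> \<bar>T $$ (i, j)\<bar> \<le> b"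
    and \<kappa>: "0 < \<kappa>" "ereal \<kappa> \<le> cond_number T" and \<epsilon>: "0 \<le> \<epsilon>" "(real n) ^ 4 * b \<le> \<kappa> * \<epsilon>"
  shows "\<exists>k<n. \<forall>x :: nat \<Rightarrow> real. (\<Sum>j<n. (x j)\<^sup>2) = 1 \<longrightarrow>
     (\<forall>i<n. i \<noteq> k \<longrightarrow> (\<Sum>j<n. T $$ (i, j) * x j) = 0) \<longrightarrow> \<bar>\<Sum>j<n. T $$ (k, j) * x j\<bar> \<le> \<epsilon>"
proof (cases "mat_inverse T")
  case None
  have "T \<notin> Units (ring_mat TYPE(real) n n)" using mat_inverse(1)[OF T None, where b = n] by simp
  then have "Determinant.det T = 0" using det_non_zero_imp_unit[OF T, where b = n] by blast
  then have "Determinant.det (transpose_mat T) = 0" using det_transpose[OF T] by simp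
  then obtain y where y: "y \<in> carrier_vec n" "y \<noteq> 0\<^sub>v n" "transpose_mat T *\<^sub>v y = 0\<^sub>v n"
    using det_0_iff_vec_prod_zero[of "transpose_mat T" n] T by auto
  have yT: "(\<Sum>i<n. T $$ (i, j) * y $ i) = 0" if "j < n" for j
  proof -
    have "(transpose_mat T *\<^sub>v y) $ j = 0" using y(3) that by simp
    then show ?thesis using T y(1) that by (simp add: scalar_prod_def atLeast0LessThan)
  qed
  obtain k where k: "k < n" "y $ k \<noteq> 0" using y(1,2) by (metis carrier_vecD eq_vecI index_zero_vec)
  show ?thesis
  proof (intro exI[of _ k] conjI allI impI k(1))
    fix x :: "nat \<Rightarrow> real" assume x: "\<forall>i<n. i \<noteq> k \<longrightarrow> (\<Sum>j<n. T $$ (i, j) * x j) = 0"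
    have "(\<Sum>i<n. y $ i * (\<Sum>j<n. T $$ (i, j) * x j)) = (\<Sum>j<n. x j * (\<Sum>i<n. T $$ (i, j) * y $ i))"
      unfolding sum_distrib_left by (subst sum.swap) (simp add: mult_ac)
    also have "\<dots> = 0" using yT by simp
    also have "(\<Sum>i<n. y $ i * (\<Sum>j<n. T $$ (i, j) * x j)) = (\<Sum>i<n. if i = k then y $ k * (\<Sum>j<n. T $$ (k, j) * x j) else 0)"
      using x by (intro sum.cong) auto
    finally have "y $ k * (\<Sum>j<n. T $$ (k, j) * x j) = 0" using k by simp
    then show "\<bar>\<Sum>j<n. T $$ (k, j) * x j\<bar> \<le> \<epsilon>" using k \<epsilon> by simp
  qed
next
  case (Some S)
  then have TS: "T * S = 1\<^sub>m n" "S * T = 1\<^sub>m n" and S: "S \<in> carrier_mat n n"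
    using mat_inverse(2)[OF T] by blast+
  let ?s = "Max ((\<lambda>p. \<bar>S $$ p\<bar>) ` ({..<n} \<times> {..<n}))"
  have "?s \<in> (\<lambda>p. \<bar>S $$ p\<bar>) ` ({..<n} \<times> {..<n})" using n by (intro Max_in) auto
  then obtain i0 k where k: "i0 < n" "k < n" and s: "?s = \<bar>S $$ (i0, k)\<bar>" by auto
  have Sle: "\<bar>S $$ (i, j)\<bar> \<le> ?s" if "i < n" "j < n" for i j
    using that by (intro Max_ge) auto
  have "cond_number T = ereal (sigma1 T * sigma1 S)" using Some by (simp add: cond_number_def)
  \<comment> \<open>The two norm bounds give \<open>\<kappa> \<le> n ^ 4 * b * ?s\<close>, so the
    hypothesis on \<open>\<epsilon>\<close> forces \<open>1 \<le> \<epsilon> * ?s\<close>.\<close>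
  then have "\<kappa> \<le> sigma1 T * sigma1 S" using \<kappa> by simp
  also have "\<dots> \<le> ((real n)\<^sup>2 * b) * ((real n)\<^sup>2 * ?s)"
  proof (intro mult_mono)
    show "sigma1 T \<le> (real n)\<^sup>2 * b" using sigma1_bounds[OF T n b] by blast
    show "sigma1 S \<le> (real n)\<^sup>2 * ?s" "0 \<le> sigma1 S" using sigma1_bounds[OF S n Sle] by blast+
    have "0 \<le> b" using b[OF n n] by linarith
    then show "0 \<le> (real n)\<^sup>2 * b" by simp
  qed
  also have "\<dots> = ((real n) ^ 4 * b) * \<bar>S $$ (i0, k)\<bar>" unfolding s by (simp add: power2_eq_square power4_eq_xxxx)
  also have "\<dots> \<le> (\<kappa> * \<epsilon>) * \<bar>S $$ (i0, k)\<bar>" using \<epsilon> by (intro mult_right_mono) auto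
  finally have \<epsilon>S: "1 \<le> \<epsilon> * \<bar>S $$ (i0, k)\<bar>" using \<kappa> by (simp add: mult.assoc)
  show ?thesis
  proof (intro exI[of _ k] conjI allI impI k(2))
    fix x :: "nat \<Rightarrow> real"
    assume x: "(\<Sum>j<n. (x j)\<^sup>2) = 1" "\<forall>i<n. i \<noteq> k \<longrightarrow> (\<Sum>j<n. T $$ (i, j) * x j) = 0"
    define c where "c = (\<Sum>j<n. T $$ (k, j) * x j)"
    \<comment> \<open>\<open>x\<close> equals \<open>S\<close> applied to \<open>T x\<close>, and
      \<open>T x\<close> is \<open>c\<close> times unit vector \<open>k\<close>. Thus
      \<open>x i0\<close> is the largest entry times \<open>c\<close>, and being at most 1 in
      modulus it bounds \<open>c\<close>.\<close>
    have "x i0 = (\<Sum>j<n. (S * T) $$ (i0, j) * x j)"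
      using k by (simp add: TS if_distrib[of "\<lambda>t. t * _"] cong: if_cong)
    also have "\<dots> = (\<Sum>j<n. (\<Sum>i<n. S $$ (i0, i) * T $$ (i, j)) * x j)"
      using S T k by (intro sum.cong) (auto simp: scalar_prod_def atLeast0LessThan)
    also have "\<dots> = (\<Sum>i<n. S $$ (i0, i) * (\<Sum>j<n. T $$ (i, j) * x j))"
      unfolding sum_distrib_right sum_distrib_left by (subst sum.swap) (simp add: mult_ac)
    also have "\<dots> = (\<Sum>i<n. if i = k then S $$ (i0, k) * c else 0)"
      using x(2) by (intro sum.cong) (auto simp: c_def)
    finally have xc: "x i0 = S $$ (i0, k) * c" using k by simp
    have "(x i0)\<^sup>2 \<le> (\<Sum>j<n. (x j)\<^sup>2)" using k by (intro member_le_sum) auto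
    then have "\<bar>S $$ (i0, k)\<bar> * \<bar>c\<bar> \<le> 1" using x(1) xc by (simp add: abs_square_le_1 abs_mult)
    also have "\<dots> \<le> \<bar>S $$ (i0, k)\<bar> * \<epsilon>" using \<epsilon>S by (simp add: mult.commute)
    finally have "\<bar>S $$ (i0, k)\<bar> * \<bar>c\<bar> \<le> \<bar>S $$ (i0, k)\<bar> * \<epsilon>" .
    moreover have "0 < \<bar>S $$ (i0, k)\<bar>" using \<epsilon>S by (cases "S $$ (i0, k) = 0") auto
    ultimately show "\<bar>\<Sum>j<n. T $$ (k, j) * x j\<bar> \<le> \<epsilon>" by (simp add: c_def mult_le_cancel_left)
  qed
qed

text \<open>These are \<open>n - 1\<close> linear equations in \<open>n\<close> unknowns: with row
  \<open>k\<close> replaced by zero, unit vector \<open>k\<close> lies in the left kernel, so the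
  determinant vanishes and a nonzero solution can be normalised.\<close>

lemma exists_unit_normal:
  fixes t :: "nat \<Rightarrow> nat \<Rightarrow> real"
  assumes k: "k < n"
  obtains x where "(\<Sum>j<n. (x j)\<^sup>2) = 1" "\<And>i. i < n \<Longrightarrow> i \<noteq> k \<Longrightarrow> (\<Sum>j<n. t i j * x j) = 0"
proof -
  define A where "A = Matrix.mat n n (\<lambda>(i, j). if i = k then 0 else t i j)"
  have A: "A \<in> carrier_mat n n" by (simp add: A_def)
  have "transpose_mat A *\<^sub>v unit_vec n k = 0\<^sub>v n"
    using k by (intro eq_vecI) (auto simp: A_def scalar_prod_def unit_vec_def if_distrib[of "\<lambda>u. _ * u"] cong: if_cong)
  moreover have "unit_vec n k \<noteq> (0\<^sub>v n :: real Matrix.vec)" using k by simp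
  ultimately have "Determinant.det (transpose_mat A) = 0"
    using det_0_iff_vec_prod_zero[of "transpose_mat A" n] A by (auto intro: unit_vec_carrier)
  then have "Determinant.det A = 0" using det_transpose[OF A] by simp
  then obtain v where v: "v \<in> carrier_vec n" "v \<noteq> 0\<^sub>v n" "A *\<^sub>v v = 0\<^sub>v n"
    using det_0_iff_vec_prod_zero[OF A] by blast
  define N where "N = (\<Sum>j<n. (v $ j)\<^sup>2)"
  obtain l where l: "l < n" "v $ l \<noteq> 0" using v(1,2) by (metis carrier_vecD eq_vecI index_zero_vec)
  have "0 < (v $ l)\<^sup>2" using l by simp
  also have "\<dots> \<le> N" unfolding N_def using l by (intro member_le_sum) auto
  finally have N: "0 < N" .
  show thesis
  proof (rule that[of "\<lambda>j. v $ j / sqrt N"])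
    show "(\<Sum>j<n. (v $ j / sqrt N)\<^sup>2) = 1"
      using N by (simp add: power_divide sum_divide_distrib[symmetric] N_def[symmetric])
    fix i assume i: "i < n" "i \<noteq> k"
    have "(A *\<^sub>v v) $ i = 0" using v(3) i by simp
    then have "(\<Sum>j<n. t i j * v $ j) = 0"
      using v(1) i by (simp add: A_def scalar_prod_def atLeast0LessThan)
    then show "(\<Sum>j<n. t i j * (v $ j / sqrt N)) = 0"
      by (simp add: sum_divide_distrib[symmetric])
  qed
qed

section \<open>The union bound over discretized normals\<close>

text \<open>The Levy concentration function of a random signed sum.\<close>
definition conc :: "'i set \<Rightarrow> ('i \<Rightarrow> real) \<Rightarrow> real \<Rightarrow> real" where
  "conc I x r = (SUP z. measure_pmf.prob (signs I) {\<xi>. \<bar>(\<Sum>i\<in>I. \<xi> i * x i) - z\<bar> \<le> r})"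

lemma bdd_above_prob: "bdd_above (range (\<lambda>z. measure_pmf.prob p (S z)))"
  by (rule bdd_aboveI[of _ 1]) auto

lemma prob_le_conc: "measure_pmf.prob (signs I) {\<xi>. \<bar>(\<Sum>i\<in>I. \<xi> i * x i) - z\<bar> \<le> r} \<le> conc I x r"
  unfolding conc_def by (intro cSUP_upper bdd_above_prob) auto

lemma conc_le_1: "conc I x r \<le> 1"
  unfolding conc_def by (rule cSUP_least) auto

text \<open>Settling for half the supremum avoids the question whether it is attained, at the cost
  of a factor 2.\<close>

lemma conc_half_attained:
  assumes "0 < conc I x r"
  obtains z where "conc I x r / 2 \<le> measure_pmf.prob (signs I) {\<xi>. \<bar>(\<Sum>i\<in>I. \<xi> i * x i) - z\<bar> \<le> r}"
proof -
  have "conc I x r / 2 < conc I x r" using assms by simp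
  then have "\<exists>z\<in>UNIV. conc I x r / 2 < measure_pmf.prob (signs I) {\<xi>. \<bar>(\<Sum>i\<in>I. \<xi> i * x i) - z\<bar> \<le> r}"
    unfolding conc_def[of I x r] using bdd_above_prob by (subst (asm) less_cSUP_iff) auto
  then show thesis using that less_imp_le by blast
qed

lemma abs_signs_le_1: "finite I \<Longrightarrow> \<xi> \<in> set_pmf (signs I) \<Longrightarrow> \<bar>\<xi> i\<bar> \<le> 1"
  unfolding signs_def by (cases "i \<in> I") (auto simp: set_Pi_pmf PiE_dflt_def)

lemma prob_mono_support:
  assumes "\<And>x. x \<in> set_pmf p \<Longrightarrow> x \<in> S \<Longrightarrow> x \<in> T"
  shows "measure_pmf.prob p S \<le> measure_pmf.prob p T"
proof -
  have "measure_pmf.prob p S = measure_pmf.prob p (S \<inter> set_pmf p)" by (rule measure_Int_set_pmf[symmetric])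
  also have "\<dots> \<le> measure_pmf.prob p T" using assms by (intro measure_pmf.finite_measure_mono) auto
  finally show ?thesis .
qed

text \<open>Replacing \<open>x / \<delta>\<close> by \<open>a\<close> moves the signed sum by at
  most \<open>card I * \<eta>\<close> in units of \<open>\<delta>\<close>, so a window for
  \<open>a\<close> sits inside a coarser window for \<open>x\<close>.\<close>

lemma prob_rounded_le_conc:
  fixes x a :: "'i \<Rightarrow> real" and \<delta> \<eta> L :: real
  assumes I: "finite I" and \<delta>: "0 < \<delta>" and a: "\<And>i. i \<in> I \<Longrightarrow> \<bar>x i / \<delta> - a i\<bar> \<le> \<eta>"
    and r: "\<delta> * (L + card I * \<eta>) \<le> r"
  shows "measure_pmf.prob (signs I) {\<xi>. \<bar>(\<Sum>i\<in>I. \<xi> i * a i) - z\<bar> \<le> L} \<le> conc I x r"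
proof -
  have "measure_pmf.prob (signs I) {\<xi>. \<bar>(\<Sum>i\<in>I. \<xi> i * a i) - z\<bar> \<le> L}
     \<le> measure_pmf.prob (signs I) {\<xi>. \<bar>(\<Sum>i\<in>I. \<xi> i * x i) - \<delta> * z\<bar> \<le> r}"
  proof (rule prob_mono_support)
    fix \<xi> assume \<xi>: "\<xi> \<in> set_pmf (signs I)" and "\<xi> \<in> {\<xi>. \<bar>(\<Sum>i\<in>I. \<xi> i * a i) - z\<bar> \<le> L}"
    then have L: "\<bar>(\<Sum>i\<in>I. \<xi> i * a i) - z\<bar> \<le> L" by simp
    have "\<bar>\<Sum>i\<in>I. \<xi> i * (x i / \<delta> - a i)\<bar> \<le> (\<Sum>i\<in>I. \<bar>\<xi> i * (x i / \<delta> - a i)\<bar>)" by (rule sum_abs)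
    also have "\<dots> \<le> (\<Sum>i\<in>I. 1 * \<eta>)"
      unfolding abs_mult using a abs_signs_le_1[OF I \<xi>] by (intro sum_mono mult_mono) auto
    finally have "\<bar>\<Sum>i\<in>I. \<xi> i * (x i / \<delta> - a i)\<bar> \<le> card I * \<eta>" by simp
    moreover have "(\<Sum>i\<in>I. \<xi> i * x i) - \<delta> * z =
        \<delta> * (((\<Sum>i\<in>I. \<xi> i * a i) - z) + (\<Sum>i\<in>I. \<xi> i * (x i / \<delta> - a i)))"
      using \<delta> by (simp add: right_diff_distrib distrib_left sum_subtractf sum_distrib_left mult.left_commute)
    ultimately have "\<bar>(\<Sum>i\<in>I. \<xi> i * x i) - \<delta> * z\<bar> \<le> \<delta> * (L + card I * \<eta>)"
      using L \<delta> by (simp add: abs_mult)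
    then show "\<xi> \<in> {\<xi>. \<bar>(\<Sum>i\<in>I. \<xi> i * x i) - \<delta> * z\<bar> \<le> r}" using r by simp
  qed
  also have "\<dots> \<le> conc I x r" by (rule prob_le_conc)
  finally show ?thesis .
qed

text \<open>Exact orthogonality survives rounding up to the accumulated error; the result is the
  event to which the union bound over integer vectors applies.\<close>

lemma abs_row_rounded_le:
  fixes t x a :: "nat \<Rightarrow> real" and b \<delta> \<eta> :: real
  assumes t: "\<And>j. j < n \<Longrightarrow> \<bar>t j\<bar> \<le> b" and x: "(\<Sum>j<n. t j * x j) = 0" and \<delta>: "0 < \<delta>" and "0 \<le> b"
    and a: "\<And>j. j < n \<Longrightarrow> \<bar>x j / \<delta> - a j\<bar> \<le> \<eta>"
  shows "\<bar>\<Sum>j<n. t j * a j\<bar> \<le> n * (b * \<eta>)"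
proof -
  have "(\<Sum>j<n. t j * (x j / \<delta>)) = 0"
    using x by (simp add: sum_divide_distrib[symmetric])
  then have "(\<Sum>j<n. t j * a j) = - (\<Sum>j<n. t j * (x j / \<delta> - a j))"
    by (simp add: right_diff_distrib sum_subtractf)
  then have "\<bar>\<Sum>j<n. t j * a j\<bar> \<le> (\<Sum>j<n. \<bar>t j * (x j / \<delta> - a j)\<bar>)" by (simp only: abs_minus_cancel sum_abs)
  also have "\<dots> \<le> (\<Sum>j<n. b * \<eta>)"
    using t a \<open>0 \<le> b\<close> by (intro sum_mono) (auto simp: abs_mult intro!: mult_mono)
  finally show ?thesis by simp
qed

section \<open>Pigeonhole over scales and magnitudes\<close>

text \<open>Otherwise \<open>f\<close> would grow by more than \<open>\<gamma>\<close> at each of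
  \<open>J\<close> steps and exceed 1. It is applied to the concentration at growing radii, with
  \<open>\<gamma> = n powr (1 / 16)\<close> and \<open>J = 16 * \<alpha>\<close>.\<close>

lemma exists_slow_growth:
  fixes f :: "nat \<Rightarrow> real"
  assumes "0 < \<gamma>" "1 < \<gamma> ^ J * f 0" "f J \<le> 1"
  shows "\<exists>j<J. f (Suc j) \<le> \<gamma> * f j"
proof (rule ccontr)
  assume "\<not> ?thesis"
  then have *: "\<gamma> * f j < f (Suc j)" if "j < J" for j using that by (simp add: not_le)
  have "\<gamma> ^ j * f 0 \<le> f j" if "j \<le> J" for j
    using that
  proof (induction j)
    case (Suc j)
    then have "\<gamma> * (\<gamma> ^ j * f 0) \<le> \<gamma> * f j" using assms(1) by (intro mult_left_mono) auto
    then show ?case using *[of j] Suc.prems by simp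
  qed simp
  from this[of J] show False using assms by simp
qed

text \<open>At the first point where \<open>g\<close> rises above the line from
  \<open>(0, 0)\<close> to \<open>(Q, s)\<close>, the previous point is still on or below it, so the
  jump is at least the slope \<open>s / Q\<close>.\<close>

lemma exists_level_jump:
  fixes g :: "nat \<Rightarrow> nat"
  assumes "g 0 = 0" "s < g Q" "0 < Q"
  obtains q where "q < Q" "real (g q) \<le> s" "real s / Q \<le> real (g (Suc q)) - real (g q)"
proof -
  define q where "q = (LEAST q. real q * (real s / Q) < g q)"
  have ex: "real Q * (real s / Q) < g Q" using assms by simp
  have q: "real q * (real s / Q) < g q" "q \<le> Q" unfolding q_def
    using LeastI[of "\<lambda>q. real q * (real s / Q) < g q", OF ex] Least_le[of "\<lambda>q. real q * (real s / Q) < g q", OF ex] by auto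
  have "q \<noteq> 0"
  proof
    assume "q = 0"
    then show False using q(1) assms(1) by simp
  qed
  then obtain p where p: "q = Suc p" by (cases q) auto
  have "\<not> real p * (real s / Q) < g p" using not_less_Least[of p "\<lambda>q. real q * (real s / Q) < g q"] p q_def by simp
  then have gp: "g p \<le> real p * (real s / Q)" by simp
  have "real p * (real s / Q) \<le> real Q * (real s / Q)" using p q by (intro mult_right_mono) auto
  then have "real (g p) \<le> s" using gp assms by simp
  moreover have "real s / Q \<le> real (g (Suc p)) - real (g p)"
  proof -
    have "real q * (real s / Q) = real p * (real s / Q) + real s / Q" by (simp only: p of_nat_Suc distrib_right mult_1 add.commute)
    then show ?thesis using q(1) gp unfolding p by linarith
  qed
  ultimately show thesis using that[of p] p q by simp
qed

text \<open>\<open>1 / n ^ D\<close> is the finest scale, \<open>s\<close> (about \<open>n powr (7/8)\<close>) the sparsity threshold, \<open>k\<close> (about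
  \<open>n powr (1/4)\<close>) the gain from translating the low-energy set, \<open>m\<close> the sample size, and \<open>64 * \<kappa>\<close> the
  proportion of coordinates allowed outside the spectrum.\<close>
locale scales =
  fixes n c \<alpha> D s k m :: nat and M \<kappa> d :: real
  assumes n: "8 \<le> n"
    and D: "D = c + 6 + (c + 3) * (16 * \<alpha>)"
    and \<kappa>: "\<kappa> = 1 / (2048 * (real D + 2))"
    and d: "d = sqrt (\<kappa> / 8)"
    and M: "M = 2 * ln (16 * real n ^ \<alpha>)"
    and k: "real n powr (1 / 4) \<le> real k"
    and kG: "2 * pi * k \<le> d * (64 * (real n)\<^sup>2)"
    and m: "16 * real n ^ D * exp (- m / 256) < 1"
    and many: "4 * M < real s / (8 * (real c + 4)) * ((d * real n powr (- 1 / 8) / (2 * k))\<^sup>2 / 4)"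
    and cap: "2 * M + 2 * (real s + n * d\<^sup>2) \<le> \<kappa> * n"
begin

text \<open>\<open>2 * n ^ D\<close> bounds the rounded coordinates, as no scale is finer than
  \<open>1 / n ^ D\<close>. The extra \<open>n\<^sup>2\<close> in the frequency range leaves room
  for \<open>k\<close> translates.\<close>

abbreviation "Y us \<equiv> spectrum (n ^ (D + 2)) (2 * n ^ D) m us"

lemma n_pow_ge: "real n \<ge> 8" "real n ^ i \<ge> 1" "0 < real n ^ i" "0 < real n"
  using n by (auto simp: one_le_power)

lemma \<kappa>_bounds: "0 < \<kappa>" "64 * \<kappa> < 1" "0 < d" "d \<le> 1"
proof -
  show "0 < \<kappa>" "64 * \<kappa> < 1" by (simp_all add: \<kappa> divide_less_eq)
  then show "0 < d" "d \<le> 1" by (simp_all add: d)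
qed

text \<open>Pigeonhole on the \<open>8 * (c + 4)\<close> levels \<open>n powr (- q / 8)\<close> from
  1 down to \<open>1 / n ^ (c + 4)\<close>. Few coordinates lie above the chosen level, which keeps
  the energy cost of translation low; many lie just below it and separate the translates.\<close>

lemma level_structure:
  fixes x :: "nat \<Rightarrow> real"
  assumes unit: "\<And>i. i < n \<Longrightarrow> \<bar>x i\<bar> \<le> 1" and dense: "s < card {i\<in>{..<n}. 1 / real n ^ (c + 4) < \<bar>x i\<bar>}"
  obtains \<tau> where "1 / real n ^ (c + 4) \<le> \<tau>" "\<tau> \<le> 1" "card {i\<in>{..<n}. \<tau> < \<bar>x i\<bar>} \<le> s"
    "real s / (8 * (real c + 4)) \<le> card {i\<in>{..<n}. real n powr (- 1 / 8) * \<tau> < \<bar>x i\<bar> \<and> \<bar>x i\<bar> \<le> \<tau>}"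
proof -
  define lev where "lev q = real n powr (- real q / 8)" for q :: nat
  define g where "g q = card {i\<in>{..<n}. lev q < \<bar>x i\<bar>}" for q
  have "{i\<in>{..<n}. lev 0 < \<bar>x i\<bar>} = {}" using unit n_pow_ge by (force simp: lev_def)
  then have g0: "g 0 = 0" by (simp add: g_def)
  have "lev (8 * (c + 4)) = 1 / real n ^ (c + 4)"
  proof -
    have "lev (8 * (c + 4)) = real n powr (- real (c + 4))"
      unfolding lev_def by (rule arg_cong[where f = "\<lambda>e. real n powr e"]) simp
    then show ?thesis using n_pow_ge(4) by (simp only: powr_minus powr_realpow) (simp add: divide_inverse)
  qed
  note levQ = this
  then have "s < g (8 * (c + 4))" using dense by (simp add: g_def)
  then obtain q where q: "q < 8 * (c + 4)" "real (g q) \<le> s" "real s / real (8 * (c + 4)) \<le> real (g (Suc q)) - real (g q)"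
    using exists_level_jump[of g s "8 * (c + 4)"] g0 by auto
  have mono: "lev q' \<le> lev p" if "p \<le> q'" for p q'
    unfolding lev_def using that n_pow_ge(1) by (intro powr_mono) auto
  have step: "lev (Suc q) = real n powr (- 1 / 8) * lev q"
    unfolding lev_def by (simp add: powr_add[symmetric] add_divide_distrib diff_divide_distrib)
  show thesis
  proof (rule that[of "lev q"])
    show "1 / real n ^ (c + 4) \<le> lev q" using mono[of q "8 * (c + 4)"] q levQ by simp
    show "lev q \<le> 1" using mono[of 0 q] n_pow_ge(4) by (simp add: lev_def)
    show "card {i\<in>{..<n}. lev q < \<bar>x i\<bar>} \<le> s" using q(2) by (simp add: g_def)
    have "g (Suc q) = card ({i\<in>{..<n}. lev q < \<bar>x i\<bar>} \<union> {i\<in>{..<n}. lev (Suc q) < \<bar>x i\<bar> \<and> \<bar>x i\<bar> \<le> lev q})"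
      unfolding g_def using mono[of q "Suc q"] by (intro arg_cong[where f = card]) auto
    also have "\<dots> \<le> g q + card {i\<in>{..<n}. lev (Suc q) < \<bar>x i\<bar> \<and> \<bar>x i\<bar> \<le> lev q}"
      unfolding g_def by (rule card_Un_le)
    finally have "real (g (Suc q)) \<le> real (g q + card {i\<in>{..<n}. lev (Suc q) < \<bar>x i\<bar> \<and> \<bar>x i\<bar> \<le> lev q})"
      by (simp only: of_nat_le_iff)
    then have last: "real s / real (8 * (c + 4)) \<le> card {i\<in>{..<n}. lev (Suc q) < \<bar>x i\<bar> \<and> \<bar>x i\<bar> \<le> lev q}"
      using q(3) by simp
    show "real s / (8 * (real c + 4)) \<le> card {i\<in>{..<n}. real n powr (- 1 / 8) * lev q < \<bar>x i\<bar> \<and> \<bar>x i\<bar> \<le> lev q}"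
    proof -
      have "real (8 * (c + 4)) = 8 * (real c + 4)" by simp
      then show ?thesis using last by (simp only: step)
    qed
  qed
qed

text \<open>Slow growth of the concentration selects the scale \<open>\<delta>\<close>. The
  structure of \<open>x / \<delta>\<close> ties \<open>card (Y us)\<close> to the concentration at
  \<open>\<delta>\<close>, hence to that at the next scale, which dominates the small ball
  probability of the rounded vector.\<close>

lemma dense_rich_structured:
  fixes x :: "nat \<Rightarrow> real"
  assumes unit: "\<And>i. i < n \<Longrightarrow> \<bar>x i\<bar> \<le> 1" and dense: "s < card {i\<in>{..<n}. 1 / real n ^ (c + 4) < \<bar>x i\<bar>}"
    and rich: "1 / real n ^ \<alpha> < conc {..<n} x (1 / real n ^ D)"
  obtains \<delta> us where "0 < \<delta>" "us \<in> {..<m} \<rightarrow>\<^sub>E {- int (2 * n ^ (D + 2))<..<int (2 * n ^ (D + 2))}"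
    "\<And>i. i < n \<Longrightarrow> round (x i / \<delta>) \<in> {- int (2 * n ^ D)..int (2 * n ^ D)}"
    "card {i\<in>{..<n}. round (x i / \<delta>) \<notin> Y us} \<le> 64 * (\<kappa> * n)"
    "\<And>z. measure_pmf.prob (signs {..<n}) {\<xi>. \<bar>(\<Sum>i<n. \<xi> i * of_int (round (x i / \<delta>))) - z\<bar> \<le> real n ^ (c + 1)}
       \<le> 8192 * real n powr (- 3 / 16) / card (Y us)"
    "Y us \<noteq> {}"
proof -
  \<comment> \<open>Neighbouring radii differ by the factor \<open>n ^ (c + 3)\<close>. By the
    choice of \<open>D\<close> they run from \<open>1 / n ^ D\<close> at index 0 to
    \<open>1 / n ^ (c + 6)\<close> at index \<open>16 * \<alpha>\<close>.\<close>
  define r where "r j = real n ^ ((c + 3) * j) / real n ^ D" for j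
  have rpos: "0 < r j" for j using n_pow_ge by (simp add: r_def)
  have rSuc: "r (Suc j) = r j * real n ^ (c + 3)" for j by (simp add: r_def power_add mult_ac)
  define \<gamma> where "\<gamma> = real n powr (1 / 16)"
  have \<gamma>: "0 < \<gamma>" using n_pow_ge(4) by (simp add: \<gamma>_def)
  have "\<gamma> ^ (16 * \<alpha>) = real n ^ \<alpha>"
  proof -
    have "\<gamma> ^ (16 * \<alpha>) = real n powr (1 / 16 * real (16 * \<alpha>))"
      using \<gamma> by (simp only: powr_realpow[symmetric]) (simp only: \<gamma>_def powr_powr)
    also have "1 / 16 * real (16 * \<alpha>) = real \<alpha>" by simp
    also have "real n powr real \<alpha> = real n ^ \<alpha>" using n_pow_ge(4) by (simp only: powr_realpow)
    finally show ?thesis .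
  qed
  then have "1 < \<gamma> ^ (16 * \<alpha>) * conc {..<n} x (r 0)"
    using rich n_pow_ge(3)[of \<alpha>] by (simp add: r_def divide_less_eq mult.commute)
  then obtain j where j: "j < 16 * \<alpha>" "conc {..<n} x (r (Suc j)) \<le> \<gamma> * conc {..<n} x (r j)"
    using exists_slow_growth[of \<gamma> "16 * \<alpha>" "\<lambda>j. conc {..<n} x (r j)"] \<gamma> conc_le_1 by blast
  have r_mono: "r i \<le> r j'" if "i \<le> j'" for i j'
    unfolding r_def using that n_pow_ge by (intro divide_right_mono power_increasing) auto
  have "conc {..<n} x (r 0) \<le> conc {..<n} x (r j)"
    unfolding conc_def
  proof (rule cSUP_mono)
    fix z :: real
    show "\<exists>z'\<in>UNIV. measure_pmf.prob (signs {..<n}) {\<xi>. \<bar>(\<Sum>i<n. \<xi> i * x i) - z\<bar> \<le> r 0}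
       \<le> measure_pmf.prob (signs {..<n}) {\<xi>. \<bar>(\<Sum>i<n. \<xi> i * x i) - z'\<bar> \<le> r j}"
      using r_mono[of 0 j] by (intro bexI[of _ z] measure_pmf.finite_measure_mono) auto
  qed (auto intro: bdd_above_prob)
  then have cj: "1 / real n ^ \<alpha> < conc {..<n} x (r j)" using rich by (simp add: r_def)
  define \<rho> where "\<rho> = conc {..<n} x (r j) / 2"
  have \<rho>: "0 < \<rho>" "1 / (2 * real n ^ \<alpha>) \<le> \<rho>"
  proof -
    have "0 < 1 / real n ^ \<alpha>" using n_pow_ge by simp
    then show "0 < \<rho>" using cj unfolding \<rho>_def by linarith
    show "1 / (2 * real n ^ \<alpha>) \<le> \<rho>" using cj by (simp add: \<rho>_def)
  qed
  then obtain z where z: "\<rho> \<le> measure_pmf.prob (signs {..<n}) {\<xi>. \<bar>(\<Sum>i<n. \<xi> i * x i) - z\<bar> \<le> r j}"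
    using conc_half_attained[of "{..<n}" x "r j"] unfolding \<rho>_def by auto
  define \<delta> where "\<delta> = r j"
  have \<delta>: "0 < \<delta>" using rpos by (simp add: \<delta>_def)
  have \<delta>_lower: "1 / \<delta> \<le> real n ^ D"
  proof -
    have "1 / real n ^ D \<le> \<delta>" using r_mono[of 0 j] by (simp add: \<delta>_def r_def)
    then show ?thesis using \<delta> n_pow_ge(3)[of D] by (simp add: field_simps)
  qed
  have \<delta>_upper: "\<delta> * real n ^ (c + 6) \<le> 1"
  proof -
    have "\<delta> \<le> r (16 * \<alpha>)" using r_mono[of j] j by (simp add: \<delta>_def)
    also have "\<dots> = 1 / real n ^ (c + 6)" using n_pow_ge by (simp add: r_def D power_add)
    finally show ?thesis using n_pow_ge(3)[of "c + 6"] by (simp add: le_divide_eq)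
  qed
  obtain \<tau> where \<tau>: "1 / real n ^ (c + 4) \<le> \<tau>" "\<tau> \<le> 1" "card {i\<in>{..<n}. \<tau> < \<bar>x i\<bar>} \<le> s"
    "real s / (8 * (real c + 4)) \<le> card {i\<in>{..<n}. real n powr (- 1 / 8) * \<tau> < \<bar>x i\<bar> \<and> \<bar>x i\<bar> \<le> \<tau>}"
    using level_structure[OF unit dense] by blast
  have "0 < 1 / real n ^ (c + 4)" using n_pow_ge(4) by simp
  then have \<tau>0: "0 < \<tau>" using \<tau>(1) by linarith
  define X where "X i = x i / \<delta>" for i
  have Xcmp: "t / \<delta> < \<bar>X i\<bar> \<longleftrightarrow> t < \<bar>x i\<bar>" "\<bar>X i\<bar> \<le> t / \<delta> \<longleftrightarrow> \<bar>x i\<bar> \<le> t" for t i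
    using \<delta> by (simp_all add: X_def abs_divide divide_less_cancel divide_le_cancel)
  have XH: "\<bar>X i\<bar> + 1 \<le> real (2 * n ^ D)" if "i < n" for i
  proof -
    have "\<bar>X i\<bar> \<le> 1 / \<delta>" using Xcmp(2)[of i 1] unit[OF that] by simp
    then show ?thesis using \<delta>_lower n_pow_ge(2)[of D] by simp
  qed
  have k0: "0 < k"
  proof -
    have "0 < real n powr (1 / 4)" using n_pow_ge by simp
    then have "0 < real k" using k by linarith
    then show ?thesis by simp
  qed
  let ?v = "real n powr (- 1 / 8) * \<tau> / \<delta>"
  obtain us where us: "us \<in> {..<m} \<rightarrow>\<^sub>E {- int (2 * n ^ (D + 2))<..<int (2 * n ^ (D + 2))}"
    "card {i\<in>{..<n}. round (X i) \<notin> Y us} \<le> 64 * (\<kappa> * n)"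
    "card (Y us) * (k * \<rho>) \<le> 4096"
  proof (rule rich_imp_structured[where I = "{..<n}" and x = X and G = "n ^ (D + 2)" and k = k and H = "2 * n ^ D"
        and m = m and M = M and c = d and v = ?v and \<tau> = "\<tau> / \<delta>" and \<rho> = \<rho> and E = "\<kappa> * n" and z = "z / \<delta>"])
    show "\<rho> \<le> measure_pmf.prob (signs {..<n}) {\<xi>. \<bar>(\<Sum>i<n. \<xi> i * X i) - z / \<delta>\<bar> \<le> 1}"
    proof -
      have "(\<Sum>i<n. \<xi> i * X i) - z / \<delta> = ((\<Sum>i<n. \<xi> i * x i) - z) / \<delta>" for \<xi>
        by (simp add: X_def sum_divide_distrib diff_divide_distrib)
      then have "{\<xi>. \<bar>(\<Sum>i<n. \<xi> i * X i) - z / \<delta>\<bar> \<le> 1} = {\<xi>. \<bar>(\<Sum>i<n. \<xi> i * x i) - z\<bar> \<le> r j}"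
        using \<delta> by (simp add: abs_divide divide_le_eq \<delta>_def)
      then show ?thesis using z by simp
    qed
    show "8 * exp (- M / 2) \<le> \<rho>"
    proof -
      have "exp (- M / 2) = 1 / (16 * real n ^ \<alpha>)" using n_pow_ge(3)[of \<alpha>] by (simp add: M exp_minus inverse_eq_divide)
      then show ?thesis using \<rho>(2) by simp
    qed
    show "0 < ?v" using \<tau>0 \<delta> n_pow_ge by simp
    have "real n powr (- 1 / 8) \<le> real n powr 0" using n_pow_ge(1) by (intro powr_mono) auto
    then have "real n powr (- 1 / 8) \<le> 1" using n_pow_ge(4) by simp
    then show "?v \<le> \<tau> / \<delta>" using \<tau>0 \<delta> by (intro divide_right_mono) (auto intro: mult_left_le_one_le)
    \<comment> \<open>\<open>\<tau>\<close> is at least \<open>1 / n ^ (c + 4)\<close> and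
      \<open>\<delta>\<close> at most \<open>1 / n ^ (c + 6)\<close>, so the ratio is at least
      \<open>n\<^sup>2\<close>; this is where \<open>8 \<le> n\<close> enters.\<close>
    show "64 \<le> \<tau> / \<delta>"
    proof -
      have "64 * \<delta> \<le> (real n)\<^sup>2 * \<delta>"
        using power_mono[of 8 "real n" 2] n_pow_ge(1) \<delta> by (intro mult_right_mono) auto
      also have "\<dots> = (\<delta> * real n ^ (c + 6)) / real n ^ (c + 4)" using n_pow_ge(4) by (simp add: power_add power2_eq_square field_simps eval_nat_numeral)
      also have "\<dots> \<le> 1 / real n ^ (c + 4)" using \<delta>_upper n_pow_ge by (intro divide_right_mono) auto
      also have "\<dots> \<le> \<tau>" by fact
      finally show ?thesis using \<delta> by (simp add: le_divide_eq)
    qed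
    show "2 * pi * k * (\<tau> / \<delta>) \<le> d * (64 * real (n ^ (D + 2)))"
    proof -
      have "\<tau> / \<delta> \<le> 1 / \<delta>" using \<tau>(2) \<delta> by (intro divide_right_mono) auto
      then have "\<tau> / \<delta> \<le> real n ^ D" using \<delta>_lower by linarith
      then have "2 * pi * k * (\<tau> / \<delta>) \<le> (d * (64 * (real n)\<^sup>2)) * real n ^ D"
        by (rule mult_mono[OF kG]) (use \<delta> \<tau>0 \<kappa>_bounds in auto)
      then show ?thesis by (simp add: power_add power2_eq_square mult_ac)
    qed
    have q: "d * ?v / (2 * k * (\<tau> / \<delta>)) = d * real n powr (- 1 / 8) / (2 * k)"
      using \<tau>0 \<delta> k0 by (simp add: field_simps)
    show "4 * M < card {i\<in>{..<n}. ?v < \<bar>X i\<bar> \<and> \<bar>X i\<bar> \<le> \<tau> / \<delta>} * ((d * ?v / (2 * k * (\<tau> / \<delta>)))\<^sup>2 / 4)"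
      unfolding q Xcmp
      by (rule less_le_trans[OF many]) (intro mult_right_mono \<tau>(4), simp)
    show "2 * M + 2 * (card {i\<in>{..<n}. \<tau> / \<delta> < \<bar>X i\<bar>} + card {..<n} * d\<^sup>2) \<le> \<kappa> * n"
      unfolding Xcmp using \<tau>(3) cap by simp
    show "\<bar>X i\<bar> + 1 \<le> real (2 * n ^ D)" if "i \<in> {..<n}" for i using XH that by simp
    show "2 * n ^ D < 32 * n ^ (D + 2)"
    proof -
      have "n ^ D \<le> n ^ (D + 2)" using n by (intro power_increasing) auto
      moreover have "0 < n ^ D" using n by simp
      ultimately show ?thesis by linarith
    qed
    show "2 * (2 * real (2 * n ^ D) + 1) * exp (- m / 256) < 1"
    proof -
      have "2 * (2 * real (2 * n ^ D) + 1) * exp (- m / 256) \<le> 16 * real n ^ D * exp (- m / 256)"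
        using n_pow_ge(2)[of D] by (intro mult_right_mono) auto
      then show ?thesis using m by (rule le_less_trans)
    qed
  qed (use \<rho> \<kappa>_bounds k0 n in auto)
  \<comment> \<open>An empty spectrum would leave all \<open>n\<close> coordinates outside, more
    than the permitted \<open>64 * \<kappa> * n\<close>.\<close>
  have Y0: "Y us \<noteq> {}"
  proof
    assume "Y us = {}"
    then have "real n \<le> 64 * (\<kappa> * n)" using us(2) by simp
    also have "\<dots> < 1 * real n" using \<kappa>_bounds(2) n_pow_ge(4) unfolding mult.assoc[symmetric] by (intro mult_strict_right_mono) auto
    finally show False by simp
  qed
  have "finite (Y us)"
    by (rule finite_subset[of _ "{- int (2 * n ^ D)..int (2 * n ^ D)}"]) (auto simp: spectrum_def)
  then have cY: "0 < card (Y us)" using Y0 by (simp add: card_gt_0_iff)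
  \<comment> \<open>The bound is \<open>\<gamma> * (2 * \<rho>)\<close> with \<open>\<rho>\<close>
    at most \<open>4096 / (card (Y us) * k)\<close>; the growth 1/16 against the gain 1/4 leaves the
    exponent -3/16.\<close>
  have conc_le: "conc {..<n} x (r (Suc j)) \<le> 8192 * real n powr (- 3 / 16) / card (Y us)"
  proof -
    have "conc {..<n} x (r (Suc j)) \<le> \<gamma> * (2 * \<rho>)" using j by (simp add: \<rho>_def)
    also have "\<dots> \<le> \<gamma> * (2 * (4096 / (card (Y us) * k)))"
      using us(3) cY k0 \<gamma> by (intro mult_left_mono) (auto simp: le_divide_eq mult_ac)
    also have "\<dots> = 8192 / card (Y us) * (\<gamma> / k)" using k0 by (simp add: field_simps)
    also have "\<gamma> / k \<le> \<gamma> / real n powr (1 / 4)"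
      using k k0 \<gamma> n_pow_ge by (intro divide_left_mono mult_pos_pos) auto
    then have "8192 / card (Y us) * (\<gamma> / k) \<le> 8192 / card (Y us) * (\<gamma> / real n powr (1 / 4))"
      by (intro mult_left_mono) auto
    also have "\<gamma> / real n powr (1 / 4) = real n powr (- 3 / 16)"
      unfolding \<gamma>_def by (simp add: powr_diff[symmetric])
    finally show ?thesis by simp
  qed
  show thesis
  proof (rule that[OF \<delta> us(1)])
    fix i assume i: "i < n"
    have "\<bar>of_int (round (X i))\<bar> \<le> real (2 * n ^ D)"
      using XH[OF i] of_int_round_abs_le[of "X i"] by linarith
    then have "\<bar>round (X i)\<bar> \<le> int (2 * n ^ D)" by linarith
    then show "round (x i / \<delta>) \<in> {- int (2 * n ^ D)..int (2 * n ^ D)}" by (simp add: X_def abs_le_iff)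
  next
    show "card {i\<in>{..<n}. round (x i / \<delta>) \<notin> Y us} \<le> 64 * (\<kappa> * n)" using us(2) by (simp add: X_def)
  next
    fix z
    have "measure_pmf.prob (signs {..<n}) {\<xi>. \<bar>(\<Sum>i<n. \<xi> i * of_int (round (x i / \<delta>))) - z\<bar> \<le> real n ^ (c + 1)}
      \<le> conc {..<n} x (r (Suc j))"
    proof (rule prob_rounded_le_conc[OF _ \<delta>])
      show "\<bar>x i / \<delta> - of_int (round (x i / \<delta>))\<bar> \<le> 1 / 2" for i
        using of_int_round_abs_le[of "x i / \<delta>"] by (simp add: abs_minus_commute)
      \<comment> \<open>The window and the total rounding error \<open>n / 2\<close> together fit
        into the ratio \<open>n ^ (c + 3)\<close> of neighbouring radii.\<close>
      have "real n ^ (c + 1) + n * (1 / 2) \<le> real n ^ (c + 1) * 2"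
        using mult_left_mono[OF n_pow_ge(2)[of c], of "real n"] by simp
      also have "\<dots> \<le> real n ^ (c + 1) * (real n)\<^sup>2"
        using power_mono[of 8 "real n" 2] n_pow_ge(1) by (intro mult_left_mono) auto
      also have "\<dots> = real n ^ (c + 3)" by (simp add: power_add power2_eq_square power3_eq_cube mult_ac)
      finally show "\<delta> * (real n ^ (c + 1) + card {..<n} * (1 / 2)) \<le> r (Suc j)"
        unfolding rSuc \<delta>_def using rpos[of j] by (intro mult_left_mono) auto
    qed auto
    then show "measure_pmf.prob (signs {..<n}) {\<xi>. \<bar>(\<Sum>i<n. \<xi> i * of_int (round (x i / \<delta>))) - z\<bar> \<le> real n ^ (c + 1)}
       \<le> 8192 * real n powr (- 3 / 16) / card (Y us)" using conc_le by simp
  qed (rule Y0)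
qed

section \<open>Union bounds for sparse and for rich normals\<close>

text \<open>Coordinates up to \<open>1 / n ^ (c + 4)\<close> become 0 and the others are rounded in
  that unit. The resulting integer vectors have at most \<open>s\<close> nonzero entries and are
  counted as lying mostly in \<open>{0}\<close>.\<close>

lemma sparse_normal_prob_le:
  fixes R :: "nat \<Rightarrow> nat \<Rightarrow> real"
  assumes R: "\<And>i j. i < n \<Longrightarrow> j < n \<Longrightarrow> \<bar>R i j\<bar> \<le> real n ^ c" and l: "l < n"
  shows "measure_pmf.prob (signs ({..<n} \<times> {..<n}))
     {f. \<exists>x. (\<Sum>j<n. (x j)\<^sup>2) = 1 \<and> card {i\<in>{..<n}. 1 / real n ^ (c + 4) < \<bar>x i\<bar>} \<le> s \<and>
        (\<forall>i<n. i \<noteq> l \<longrightarrow> (\<Sum>j<n. (R i j + f (i, j)) * x j) = 0)}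
     \<le> ((real n + 1) * (2 * real n ^ (c + 4) + 1)) ^ s * (1 / 2) ^ (n - 1)"
proof -
  define H where "H = n ^ (c + 4)"
  define \<beta> where "\<beta> = 1 / real H"
  define B where "B = {- int H..int H}"
  \<comment> \<open>The second condition, an entry longer than the window, is what yields
    probability 1/2 per row.\<close>
  define V where "V = {a \<in> {..<n} \<rightarrow>\<^sub>E B. card {i\<in>{..<n}. a i \<notin> {0}} \<le> s} \<inter> {a. \<exists>i<n. 2 * real n ^ (c + 1) < \<bar>of_int (a i)\<bar>}"
  have finV: "finite V"
  proof -
    have "finite ({..<n} \<rightarrow>\<^sub>E B)" by (intro finite_PiE) (auto simp: B_def)
    then show ?thesis unfolding V_def by (rule rev_finite_subset) auto
  qed
  have H0: "1 \<le> H" using n by (simp add: H_def)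
  then have \<beta>: "0 < \<beta>" by (simp add: \<beta>_def)
  have "measure_pmf.prob (signs ({..<n} \<times> {..<n}))
     {f. \<exists>x. (\<Sum>j<n. (x j)\<^sup>2) = 1 \<and> card {i\<in>{..<n}. 1 / real n ^ (c + 4) < \<bar>x i\<bar>} \<le> s \<and>
        (\<forall>i<n. i \<noteq> l \<longrightarrow> (\<Sum>j<n. (R i j + f (i, j)) * x j) = 0)}
    \<le> measure_pmf.prob (signs ({..<n} \<times> {..<n}))
      {f. \<exists>a\<in>V. \<forall>i<n. i \<noteq> l \<longrightarrow> \<bar>\<Sum>j<n. (R i j + f (i, j)) * of_int (a j)\<bar> \<le> 2 * real n ^ (c + 1)}"
  proof (rule prob_mono_support)
    fix f assume f: "f \<in> set_pmf (signs ({..<n} \<times> {..<n}))"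
      and "f \<in> {f. \<exists>x. (\<Sum>j<n. (x j)\<^sup>2) = 1 \<and> card {i\<in>{..<n}. 1 / real n ^ (c + 4) < \<bar>x i\<bar>} \<le> s \<and>
        (\<forall>i<n. i \<noteq> l \<longrightarrow> (\<Sum>j<n. (R i j + f (i, j)) * x j) = 0)}"
    then obtain x where x: "(\<Sum>j<n. (x j)\<^sup>2) = 1" "card {i\<in>{..<n}. \<beta> < \<bar>x i\<bar>} \<le> s"
      "\<And>i. i < n \<Longrightarrow> i \<noteq> l \<Longrightarrow> (\<Sum>j<n. (R i j + f (i, j)) * x j) = 0"
      by (auto simp: \<beta>_def H_def)
    define a where "a = restrict (\<lambda>i. if \<beta> < \<bar>x i\<bar> then round (x i / \<beta>) else 0) {..<n}"
    have xle: "\<bar>x i\<bar> \<le> 1" if "i < n" for i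
    proof -
      have "(x i)\<^sup>2 \<le> (\<Sum>j<n. (x j)\<^sup>2)" using that by (intro member_le_sum) auto
      then show ?thesis using x(1) by (simp add: abs_square_le_1)
    qed
    have aB: "a i \<in> B" if "i < n" for i
    proof -
      have "\<bar>x i / \<beta>\<bar> \<le> real H" using xle[OF that] H0 by (simp add: \<beta>_def abs_mult mult_left_le_one_le)
      then have xH: "- of_int (int H) \<le> x i / \<beta>" "x i / \<beta> \<le> of_int (int H)"
        unfolding of_int_of_nat_eq by linarith+
      have "round (- of_int (int H) :: real) \<le> round (x i / \<beta>)" "round (x i / \<beta>) \<le> round (of_int (int H) :: real)"
        by (rule round_mono[OF xH(1)], rule round_mono[OF xH(2)])
      moreover have "round (- of_int (int H) :: real) = - int H"
        using round_of_int[of "- int H", where 'a = real] by simp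
      ultimately have "round (x i / \<beta>) \<in> B" by (simp add: B_def)
      then show ?thesis using that by (simp add: a_def B_def)
    qed
    \<comment> \<open>Zeroing small coordinates raises the error from 1/2 to 1, whence the window
      \<open>2 * n ^ (c + 1)\<close> below.\<close>
    have aerr: "\<bar>x i / \<beta> - of_int (a i)\<bar> \<le> 1" if "i < n" for i
    proof (cases "\<beta> < \<bar>x i\<bar>")
      case True
      have "\<bar>x i / \<beta> - of_int (round (x i / \<beta>))\<bar> \<le> 1" using of_int_round_abs_le[of "x i / \<beta>"] by linarith
      then show ?thesis using that True by (simp add: a_def)
    next
      case False
      then show ?thesis using that \<beta> by (simp add: a_def abs_divide divide_le_eq)
    qed
    have "a \<in> V"
    proof -
      have "{i\<in>{..<n}. a i \<notin> {0}} \<subseteq> {i\<in>{..<n}. \<beta> < \<bar>x i\<bar>}" by (auto simp: a_def split: if_splits)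
      then have "card {i\<in>{..<n}. a i \<notin> {0}} \<le> card {i\<in>{..<n}. \<beta> < \<bar>x i\<bar>}" by (intro card_mono) auto
      then have cs: "card {i\<in>{..<n}. a i \<notin> {0}} \<le> s" using x(2) by simp
      have ext: "a \<in> {..<n} \<rightarrow>\<^sub>E B" using aB by (auto simp: PiE_iff a_def extensional_def)
      \<comment> \<open>Otherwise the squares would sum to at most \<open>1 / n\<close>. In units of
        \<open>\<beta>\<close> a coordinate of size \<open>1 / n\<close> is
        \<open>n ^ (c + 3)\<close>, beyond the window even after rounding.\<close>
      have "\<exists>i<n. 1 / real n \<le> \<bar>x i\<bar>"
      proof (rule ccontr)
        assume "\<not> ?thesis"
        then have small: "\<bar>x i\<bar> < 1 / real n" if "i < n" for i using that by (auto simp: not_le)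
        have "(\<Sum>j<n. (x j)\<^sup>2) \<le> (\<Sum>j<n. (1 / real n)\<^sup>2)"
        proof (rule sum_mono)
          fix i assume "i \<in> {..<n}"
          then have "\<bar>x i\<bar> \<le> \<bar>1 / real n\<bar>" using small[of i] by simp
          then show "(x i)\<^sup>2 \<le> (1 / real n)\<^sup>2" by (simp only: abs_le_square_iff)
        qed
        also have "\<dots> = 1 / real n" by (simp add: power2_eq_square)
        finally show False using x(1) n_pow_ge(1) by (simp add: le_divide_eq)
      qed
      then obtain i where i: "i < n" "1 / real n \<le> \<bar>x i\<bar>" by blast
      have "2 * real n ^ (c + 1) + 1 < real n ^ (c + 3)"
      proof -
        have "2 * real n ^ (c + 1) + 1 < real n ^ (c + 1) * 64" using n_pow_ge(2)[of "c + 1"] by linarith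
        also have "\<dots> \<le> real n ^ (c + 1) * (real n)\<^sup>2"
          using power_mono[of 8 "real n" 2] n_pow_ge by (intro mult_left_mono) auto
        finally show ?thesis by (simp add: power_add power2_eq_square power3_eq_cube mult_ac)
      qed
      also have "real n ^ (c + 3) = 1 / real n / \<beta>"
        using n_pow_ge(4) by (simp add: \<beta>_def H_def eval_nat_numeral)
      also have "\<dots> \<le> \<bar>x i\<bar> / \<beta>" using i \<beta> by (intro divide_right_mono) auto
      also have "\<dots> = \<bar>x i / \<beta>\<bar>" using \<beta> by simp
      finally have "2 * real n ^ (c + 1) + 1 < \<bar>x i / \<beta>\<bar>" .
      then have "2 * real n ^ (c + 1) < \<bar>of_int (a i)\<bar>" using aerr[OF i(1)] by linarith
      then show ?thesis using i(1) cs ext unfolding V_def by blast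
    qed
    moreover have "\<bar>\<Sum>j<n. (R i j + f (i, j)) * of_int (a j)\<bar> \<le> 2 * real n ^ (c + 1)" if i: "i < n" "i \<noteq> l" for i
    proof -
      have "\<bar>\<Sum>j<n. (R i j + f (i, j)) * of_int (a j)\<bar> \<le> n * (2 * real n ^ c * 1)"
      proof (rule abs_row_rounded_le[OF _ x(3)[OF i] \<beta>])
        fix j assume "j < n"
        show "\<bar>R i j + f (i, j)\<bar> \<le> 2 * real n ^ c"
          using R[OF i(1) \<open>j < n\<close>] n_pow_ge(2)[of c]
            abs_signs_le_1[OF finite_cartesian_product[OF finite_lessThan finite_lessThan] f, of "(i, j)"]
          by linarith
      qed (use aerr n_pow_ge in auto)
      then show ?thesis by (simp add: mult_ac)
    qed
    ultimately show "f \<in> {f. \<exists>a\<in>V. \<forall>i<n. i \<noteq> l \<longrightarrow> \<bar>\<Sum>j<n. (R i j + f (i, j)) * of_int (a j)\<bar> \<le> 2 * real n ^ (c + 1)}"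
      by blast
  qed
  also have "\<dots> \<le> card V * (1 / 2) ^ (n - 1)"
  proof (rule prob_exists_small_image_le[OF finV l])
    fix a z assume "a \<in> V"
    then obtain i where "i < n" "2 * real n ^ (c + 1) < \<bar>of_int (a i)\<bar>" by (auto simp: V_def)
    then show "measure_pmf.prob (signs {..<n}) {\<xi>. \<bar>(\<Sum>j<n. \<xi> j * of_int (a j)) - z\<bar> \<le> 2 * real n ^ (c + 1)} \<le> 1 / 2"
      by (intro prob_small_ball_le_half) auto
  qed
  also have "\<dots> \<le> ((real n + 1) * (2 * real n ^ (c + 4) + 1)) ^ s * (1 / 2) ^ (n - 1)"
  proof (rule mult_right_mono)
    have "card V \<le> card {a \<in> {..<n} \<rightarrow>\<^sub>E B. card {i\<in>{..<n}. a i \<notin> {0}} \<le> s}"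
      unfolding V_def by (rule card_mono[OF rev_finite_subset[of "{..<n} \<rightarrow>\<^sub>E B"]]) (auto intro!: finite_PiE simp: B_def)
    also have "\<dots> \<le> ((card {..<n} + 1) * card B) ^ s * card {0::int} ^ card {..<n}"
      by (rule card_mostly_in_le) (auto simp: B_def)
    also have "\<dots> = ((n + 1) * (2 * H + 1)) ^ s" by (simp add: B_def nat_add_distrib nat_mult_distrib)
    finally have "real (card V) \<le> real (((n + 1) * (2 * H + 1)) ^ s)" by (simp only: of_nat_le_iff)
    then show "real (card V) \<le> ((real n + 1) * (2 * real n ^ (c + 4) + 1)) ^ s"
      by (simp only: H_def of_nat_mult of_nat_power of_nat_add of_nat_1 of_nat_numeral)
  qed simp
  finally show ?thesis .
qed

text \<open>For each sample there are about \<open>card (Y us) ^ n\<close> integer vectors, up to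
  the choices at exceptional coordinates, and each row is good with probability at most
  \<open>8192 * n powr (- 3 / 16) / card (Y us)\<close>. All but one factor
  \<open>card (Y us)\<close> cancel, so the gain \<open>n powr (- 3 / 16)\<close> per row
  remains.\<close>

lemma dense_rich_normal_prob_le:
  fixes R :: "nat \<Rightarrow> nat \<Rightarrow> real"
  assumes R: "\<And>i j. i < n \<Longrightarrow> j < n \<Longrightarrow> \<bar>R i j\<bar> \<le> real n ^ c" and l: "l < n"
  shows "measure_pmf.prob (signs ({..<n} \<times> {..<n}))
     {f. \<exists>x. (\<Sum>j<n. (x j)\<^sup>2) = 1 \<and> s < card {i\<in>{..<n}. 1 / real n ^ (c + 4) < \<bar>x i\<bar>} \<and>
        1 / real n ^ \<alpha> < conc {..<n} x (1 / real n ^ D) \<and>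
        (\<forall>i<n. i \<noteq> l \<longrightarrow> (\<Sum>j<n. (R i j + f (i, j)) * x j) = 0)}
     \<le> (4 * real n ^ (D + 2)) ^ m * (((real n + 1) * (4 * real n ^ D + 1)) ^ nat \<lfloor>64 * (\<kappa> * n)\<rfloor>
         * (4 * real n ^ D + 1) * (8192 * real n powr (- 3 / 16)) ^ (n - 1))"
proof -
  define t where "t = nat \<lfloor>64 * (\<kappa> * n)\<rfloor>"
  define B where "B = {- int (2 * n ^ D)..int (2 * n ^ D)}"
  define p where "p us = 8192 * real n powr (- 3 / 16) / card (Y us)" for us
  define U where "U = {us \<in> {..<m} \<rightarrow>\<^sub>E {- int (2 * n ^ (D + 2))<..<int (2 * n ^ (D + 2))}. Y us \<noteq> {}}"
  \<comment> \<open>The small ball bound is built into \<open>V us\<close>: it is inherited from the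
    normal that was rounded and does not follow from being mostly in \<open>Y us\<close>.\<close>
  define V where "V us = {a \<in> {..<n} \<rightarrow>\<^sub>E B. card {i\<in>{..<n}. a i \<notin> Y us} \<le> t} \<inter>
    {a. \<forall>z. measure_pmf.prob (signs {..<n}) {\<xi>. \<bar>(\<Sum>i<n. \<xi> i * of_int (a i)) - z\<bar> \<le> real n ^ (c + 1)} \<le> p us}" for us
  define F where "F us = {f. \<exists>a\<in>V us. \<forall>i<n. i \<noteq> l \<longrightarrow> \<bar>\<Sum>j<n. (R i j + f (i, j)) * of_int (a j)\<bar> \<le> real n ^ (c + 1)}" for us
  have cB: "real (card B) = 4 * real n ^ D + 1" by (simp add: B_def nat_add_distrib)
  have finPi: "finite ({..<n} \<rightarrow>\<^sub>E B)" by (intro finite_PiE) (auto simp: B_def)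
  then have finV: "finite (V us)" for us unfolding V_def by (rule rev_finite_subset) auto
  have finP: "finite ({..<m} \<rightarrow>\<^sub>E {- int (2 * n ^ (D + 2))<..<int (2 * n ^ (D + 2))})" by (intro finite_PiE) auto
  then have finU: "finite U" unfolding U_def by (rule rev_finite_subset) auto
  have cU: "real (card U) \<le> (4 * real n ^ (D + 2)) ^ m"
  proof -
    have "card U \<le> card ({..<m} \<rightarrow>\<^sub>E {- int (2 * n ^ (D + 2))<..<int (2 * n ^ (D + 2))})"
      unfolding U_def by (intro card_mono finP) auto
    also have "\<dots> = card {- int (2 * n ^ (D + 2))<..<int (2 * n ^ (D + 2))} ^ m" by (simp add: card_PiE)
    also have "\<dots> \<le> (4 * n ^ (D + 2)) ^ m"
      by (intro power_mono) (auto simp: nat_le_iff)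
    finally have "real (card U) \<le> real ((4 * n ^ (D + 2)) ^ m)" by (simp only: of_nat_le_iff)
    then show ?thesis by simp
  qed
  have "measure_pmf.prob (signs ({..<n} \<times> {..<n}))
     {f. \<exists>x. (\<Sum>j<n. (x j)\<^sup>2) = 1 \<and> s < card {i\<in>{..<n}. 1 / real n ^ (c + 4) < \<bar>x i\<bar>} \<and>
        1 / real n ^ \<alpha> < conc {..<n} x (1 / real n ^ D) \<and>
        (\<forall>i<n. i \<noteq> l \<longrightarrow> (\<Sum>j<n. (R i j + f (i, j)) * x j) = 0)}
    \<le> measure_pmf.prob (signs ({..<n} \<times> {..<n})) (\<Union>us\<in>U. F us)"
  proof (rule prob_mono_support)
    fix f assume f: "f \<in> set_pmf (signs ({..<n} \<times> {..<n}))"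
      and "f \<in> {f. \<exists>x. (\<Sum>j<n. (x j)\<^sup>2) = 1 \<and> s < card {i\<in>{..<n}. 1 / real n ^ (c + 4) < \<bar>x i\<bar>} \<and>
        1 / real n ^ \<alpha> < conc {..<n} x (1 / real n ^ D) \<and>
        (\<forall>i<n. i \<noteq> l \<longrightarrow> (\<Sum>j<n. (R i j + f (i, j)) * x j) = 0)}"
    then obtain x where x: "(\<Sum>j<n. (x j)\<^sup>2) = 1" "s < card {i\<in>{..<n}. 1 / real n ^ (c + 4) < \<bar>x i\<bar>}"
      "1 / real n ^ \<alpha> < conc {..<n} x (1 / real n ^ D)"
      "\<And>i. i < n \<Longrightarrow> i \<noteq> l \<Longrightarrow> (\<Sum>j<n. (R i j + f (i, j)) * x j) = 0" by blast
    have xle: "\<bar>x i\<bar> \<le> 1" if "i < n" for i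
    proof -
      have "(x i)\<^sup>2 \<le> (\<Sum>j<n. (x j)\<^sup>2)" using that by (intro member_le_sum) auto
      then show ?thesis using x(1) by (simp add: abs_square_le_1)
    qed
    obtain \<delta> us where \<delta>: "0 < \<delta>" and us: "us \<in> {..<m} \<rightarrow>\<^sub>E {- int (2 * n ^ (D + 2))<..<int (2 * n ^ (D + 2))}"
      "\<And>i. i < n \<Longrightarrow> round (x i / \<delta>) \<in> B"
      "card {i\<in>{..<n}. round (x i / \<delta>) \<notin> Y us} \<le> 64 * (\<kappa> * n)"
      "\<And>z. measure_pmf.prob (signs {..<n}) {\<xi>. \<bar>(\<Sum>i<n. \<xi> i * of_int (round (x i / \<delta>))) - z\<bar> \<le> real n ^ (c + 1)} \<le> p us"
      "Y us \<noteq> {}"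
      by (rule dense_rich_structured[OF xle x(2,3)]) (auto simp only: B_def p_def)
    define a where "a = restrict (\<lambda>i. round (x i / \<delta>)) {..<n}"
    have "a \<in> V us"
    proof -
      have "{i\<in>{..<n}. a i \<notin> Y us} = {i\<in>{..<n}. round (x i / \<delta>) \<notin> Y us}" by (auto simp: a_def)
      then have "card {i\<in>{..<n}. a i \<notin> Y us} \<le> t" using us(3) unfolding t_def by (simp add: le_nat_floor)
      moreover have "(\<Sum>i<n. \<xi> i * of_int (a i)) = (\<Sum>i<n. \<xi> i * of_int (round (x i / \<delta>)))" for \<xi> :: "nat \<Rightarrow> real"
        by (intro sum.cong) (auto simp: a_def)
      ultimately show ?thesis using us(2,4) by (auto simp: V_def a_def)
    qed
    moreover have "\<bar>\<Sum>j<n. (R i j + f (i, j)) * of_int (a j)\<bar> \<le> real n ^ (c + 1)" if i: "i < n" "i \<noteq> l" for i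
    proof -
      have "\<bar>\<Sum>j<n. (R i j + f (i, j)) * of_int (a j)\<bar> \<le> n * (2 * real n ^ c * (1 / 2))"
      proof (rule abs_row_rounded_le[OF _ x(4)[OF i] \<delta>])
        fix j assume "j < n"
        show "\<bar>R i j + f (i, j)\<bar> \<le> 2 * real n ^ c"
          using R[OF i(1) \<open>j < n\<close>] n_pow_ge(2)[of c]
            abs_signs_le_1[OF finite_cartesian_product[OF finite_lessThan finite_lessThan] f, of "(i, j)"]
          by linarith
        show "\<bar>x j / \<delta> - of_int (a j)\<bar> \<le> 1 / 2"
          using \<open>j < n\<close> of_int_round_abs_le[of "x j / \<delta>"] by (simp add: a_def abs_minus_commute)
      qed (use n_pow_ge in auto)
      then show ?thesis by simp
    qed
    ultimately have "f \<in> F us" unfolding F_def by blast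
    then show "f \<in> (\<Union>us\<in>U. F us)" using us(1,5) unfolding U_def by blast
  qed
  also have "\<dots> \<le> (\<Sum>us\<in>U. measure_pmf.prob (signs ({..<n} \<times> {..<n})) (F us))"
    by (rule measure_pmf.finite_measure_subadditive_finite[OF finU]) auto
  also have "\<dots> \<le> (\<Sum>us\<in>U. ((real n + 1) * (4 * real n ^ D + 1)) ^ t * (4 * real n ^ D + 1) * (8192 * real n powr (- 3 / 16)) ^ (n - 1))"
  proof (rule sum_mono)
    fix us assume us: "us \<in> U"
    have Ysub: "Y us \<subseteq> B" by (auto simp: spectrum_def B_def)
    then have finY: "finite (Y us)" using finite_subset by (auto simp: B_def)
    then have cY: "0 < card (Y us)" using us by (simp add: U_def card_gt_0_iff)
    have cYB: "real (card (Y us)) \<le> 4 * real n ^ D + 1"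
    proof -
      have "card (Y us) \<le> card B" by (rule card_mono[OF _ Ysub]) (simp add: B_def)
      then have "real (card (Y us)) \<le> real (card B)" by (simp only: of_nat_le_iff)
      then show ?thesis by (simp only: cB)
    qed
    have "measure_pmf.prob (signs ({..<n} \<times> {..<n})) (F us) \<le> card (V us) * p us ^ (n - 1)"
      unfolding F_def by (rule prob_exists_small_image_le[OF finV l]) (auto simp: V_def)
    also have "\<dots> \<le> ((real n + 1) * (4 * real n ^ D + 1)) ^ t * real (card (Y us)) ^ n * p us ^ (n - 1)"
    proof (rule mult_right_mono)
      have "card (V us) \<le> card {a \<in> {..<n} \<rightarrow>\<^sub>E B. card {i\<in>{..<n}. a i \<notin> Y us} \<le> t}"
        unfolding V_def by (rule card_mono[OF rev_finite_subset[OF finPi]]) auto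
      also have "\<dots> \<le> ((card {..<n} + 1) * card B) ^ t * card (Y us) ^ card {..<n}"
        using us Ysub by (intro card_mostly_in_le) (auto simp: B_def U_def)
      finally have "real (card (V us)) \<le> real (((card {..<n} + 1) * card B) ^ t * card (Y us) ^ card {..<n})"
        by (simp only: of_nat_le_iff)
      then show "real (card (V us)) \<le> ((real n + 1) * (4 * real n ^ D + 1)) ^ t * real (card (Y us)) ^ n"
        by (simp only: cB card_lessThan of_nat_mult of_nat_power of_nat_add of_nat_1)
    qed (simp add: p_def)
    also have "real (card (Y us)) ^ n * p us ^ (n - 1) = card (Y us) * (8192 * real n powr (- 3 / 16)) ^ (n - 1)"
    proof -
      have "real (card (Y us)) ^ n = card (Y us) * real (card (Y us)) ^ (n - 1)"
        using n by (cases n) auto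
      then show ?thesis using cY by (simp add: p_def power_divide)
    qed
    then have "((real n + 1) * (4 * real n ^ D + 1)) ^ t * real (card (Y us)) ^ n * p us ^ (n - 1) =
      ((real n + 1) * (4 * real n ^ D + 1)) ^ t * (card (Y us) * (8192 * real n powr (- 3 / 16)) ^ (n - 1))"
      by (simp only: mult.assoc)
    also have "\<dots> \<le> ((real n + 1) * (4 * real n ^ D + 1)) ^ t * ((4 * real n ^ D + 1) * (8192 * real n powr (- 3 / 16)) ^ (n - 1))"
      using cYB by (intro mult_left_mono mult_right_mono) auto
    finally show "measure_pmf.prob (signs ({..<n} \<times> {..<n})) (F us)
      \<le> ((real n + 1) * (4 * real n ^ D + 1)) ^ t * (4 * real n ^ D + 1) * (8192 * real n powr (- 3 / 16)) ^ (n - 1)"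
      by (simp only: mult.assoc)
  qed
  also have "\<dots> = card U * (((real n + 1) * (4 * real n ^ D + 1)) ^ t * (4 * real n ^ D + 1) * (8192 * real n powr (- 3 / 16)) ^ (n - 1))"
    by simp
  also have "\<dots> \<le> (4 * real n ^ (D + 2)) ^ m * (((real n + 1) * (4 * real n ^ D + 1)) ^ t * (4 * real n ^ D + 1) * (8192 * real n powr (- 3 / 16)) ^ (n - 1))"
    using cU by (intro mult_right_mono) auto
  finally show ?thesis by (simp only: t_def)
qed

end

section \<open>Asymptotics\<close>

text \<open>The first three give \<open>kG\<close>, \<open>many\<close> and \<open>cap\<close> of
  the locale; the last two are logarithms of the union bounds for sparse and rich normals. The
  decisive exponents are \<open>7/8 - 2 * (1/8 + 1/4) = 1/8\<close> in the second and
  \<open>1/32 < 3/16\<close> in the last.\<close>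

lemma eventually_scale_inequalities:
  fixes c \<alpha> D d \<kappa> :: real
  assumes "0 \<le> c" "0 \<le> \<alpha>" "0 \<le> D" "0 < d" "0 < \<kappa>"
  shows "\<forall>\<^sub>F n in sequentially. 2 * pi * (real n powr (1/4) + 1) \<le> d * (64 * (real n)\<^sup>2)"
    and "\<forall>\<^sub>F n in sequentially. 4 * (2 * (ln 16 + \<alpha> * ln (real n))) <
       (real n powr (7/8) - 1) / (8 * (c + 4)) * ((d * real n powr (- 1 / 8) / (2 * (real n powr (1/4) + 1)))\<^sup>2 / 4)"
    and "\<forall>\<^sub>F n in sequentially. 2 * (2 * (ln 16 + \<alpha> * ln (real n))) + 2 * (real n powr (7/8) + real n * (\<kappa> / 8)) \<le> \<kappa> * real n"
    and "\<forall>\<^sub>F n in sequentially. real n powr (7/8) * ((c + 7) * ln (real n)) - (real n - 1) * ln 2 \<le> - (\<alpha> * ln (real n))"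
    and "\<forall>\<^sub>F n in sequentially. (256 * (ln 16 + D * ln (real n)) + 2) * ((D + 3) * ln (real n)) + real n / 32 * ln (real n)
       + (D + 1) * ln (real n) + (real n - 1) * (ln 8192 - 3 / 16 * ln (real n)) \<le> - (\<alpha> * ln (real n))"
proof -
  show "\<forall>\<^sub>F n in sequentially. 2 * pi * (real n powr (1/4) + 1) \<le> d * (64 * (real n)\<^sup>2)"
    using assms by real_asymp
  show "\<forall>\<^sub>F n in sequentially. 4 * (2 * (ln 16 + \<alpha> * ln (real n))) <
       (real n powr (7/8) - 1) / (8 * (c + 4)) * ((d * real n powr (- 1 / 8) / (2 * (real n powr (1/4) + 1)))\<^sup>2 / 4)"
  proof -
    define e where "e = 8 * (c + 4)"
    have "0 < e" using assms by (simp add: e_def)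
    then show ?thesis unfolding e_def[symmetric] using assms by real_asymp
  qed
  show "\<forall>\<^sub>F n in sequentially. 2 * (2 * (ln 16 + \<alpha> * ln (real n))) + 2 * (real n powr (7/8) + real n * (\<kappa> / 8)) \<le> \<kappa> * real n"
    using assms by real_asymp
  show "\<forall>\<^sub>F n in sequentially. real n powr (7/8) * ((c + 7) * ln (real n)) - (real n - 1) * ln 2 \<le> - (\<alpha> * ln (real n))"
    using assms by real_asymp
  show "\<forall>\<^sub>F n in sequentially. (256 * (ln 16 + D * ln (real n)) + 2) * ((D + 3) * ln (real n)) + real n / 32 * ln (real n)
       + (D + 1) * ln (real n) + (real n - 1) * (ln 8192 - 3 / 16 * ln (real n)) \<le> - (\<alpha> * ln (real n))"
    using assms by real_asymp
qed

text \<open>\<open>\<kappa>\<close> is chosen so that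
  \<open>64 * \<kappa> * (D + 2) = 1 / 32\<close>: the exceptional coordinates, each costing at most
  \<open>n ^ (D + 2)\<close>, then cost at most \<open>n powr (n / 32)\<close> in total, less than
  the gain from the rows.\<close>

lemma eventually_scales:
  fixes c \<alpha> :: nat
  defines "D \<equiv> c + 6 + (c + 3) * (16 * \<alpha>)"
  defines "\<kappa> \<equiv> 1 / (2048 * (real D + 2))"
  shows "\<forall>\<^sub>F n in sequentially. \<exists>s k m M d. scales n c \<alpha> D s k m M \<kappa> d \<and>
     ((real n + 1) * (2 * real n ^ (c + 4) + 1)) ^ s * (1 / 2) ^ (n - 1) \<le> 1 / real n ^ \<alpha> \<and>
     (4 * real n ^ (D + 2)) ^ m * (((real n + 1) * (4 * real n ^ D + 1)) ^ nat \<lfloor>64 * (\<kappa> * n)\<rfloor>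
         * (4 * real n ^ D + 1) * (8192 * real n powr (- 3 / 16)) ^ (n - 1)) \<le> 1 / real n ^ \<alpha>"
proof -
  define d where "d = sqrt (\<kappa> / 8)"
  have \<kappa>: "0 < \<kappa>" by (simp add: \<kappa>_def)
  then have d: "0 < d" "d\<^sup>2 = \<kappa> / 8" by (simp_all add: d_def)
  have pos: "0 \<le> real c" "0 \<le> real \<alpha>" "0 \<le> real D" by simp_all
  show ?thesis
    using eventually_scale_inequalities[OF pos d(1) \<kappa>] eventually_ge_at_top[of 16]
  proof eventually_elim
    case (elim n)
    define L where "L = ln (real n)"
    have n: "16 \<le> real n" "0 < real n" using elim(6) by auto
    then have L0: "0 \<le> L" by (simp add: L_def)
    have lnpow: "ln (real n ^ i) = real i * L" for i using n by (simp add: L_def ln_realpow)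
    have powpos: "0 < real n ^ i" "1 \<le> real n ^ i" for i using n by (auto simp: one_le_power)
    have n1: "real (n - 1) = real n - 1" using elim(6) by (simp add: of_nat_diff)
    define s where "s = nat \<lfloor>real n powr (7 / 8)\<rfloor>"
    define k where "k = nat \<lceil>real n powr (1 / 4)\<rceil>"
    \<comment> \<open>The \<open>+ 1\<close> makes the inequality
      \<open>16 * n ^ D * exp (- m / 256) < 1\<close> strict.\<close>
    define m where "m = nat \<lceil>256 * (ln 16 + real D * L)\<rceil> + 1"
    define M where "M = 2 * ln (16 * real n ^ \<alpha>)"
    have s: "real n powr (7 / 8) - 1 \<le> real s" "real s \<le> real n powr (7 / 8)"
    proof -
      have "0 \<le> real n powr (7 / 8)" by simp
      then show "real n powr (7 / 8) - 1 \<le> real s" "real s \<le> real n powr (7 / 8)" unfolding s_def by linarith+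
    qed
    have k: "real n powr (1 / 4) \<le> real k" "real k \<le> real n powr (1 / 4) + 1"
    proof -
      have "0 \<le> real n powr (1 / 4)" by simp
      then show "real n powr (1 / 4) \<le> real k" "real k \<le> real n powr (1 / 4) + 1" unfolding k_def by linarith+
    qed
    have "0 < real n powr (1 / 4)" using n by simp
    then have k0: "0 < real k" using k(1) by linarith
    have m: "256 * (ln 16 + real D * L) < real m" "real m \<le> 256 * (ln 16 + real D * L) + 2"
    proof -
      have "0 \<le> 256 * (ln 16 + real D * L)" using L0 by simp
      then show "256 * (ln 16 + real D * L) < real m" "real m \<le> 256 * (ln 16 + real D * L) + 2" unfolding m_def by linarith+
    qed
    have M': "M = 2 * (ln 16 + real \<alpha> * L)"
      using powpos(1)[of \<alpha>] by (simp add: M_def ln_mult lnpow)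
    have "scales n c \<alpha> D s k m M \<kappa> d"
    proof
      show "8 \<le> n" using elim(6) by simp
      show "2 * pi * k \<le> d * (64 * (real n)\<^sup>2)"
        by (rule order_trans[OF mult_left_mono[OF k(2)] elim(1)]) simp
      show "16 * real n ^ D * exp (- m / 256) < 1"
      proof -
        have "16 * real n ^ D = exp (ln 16 + real D * L)"
          using powpos(1)[of D] by (simp add: exp_add lnpow[symmetric])
        then have "16 * real n ^ D * exp (- m / 256) = exp (ln 16 + real D * L - m / 256)"
          by (simp add: mult_exp_exp)
        also have "\<dots> < 1" using m(1) by simp
        finally show ?thesis .
      qed
      show "4 * M < real s / (8 * (real c + 4)) * ((d * real n powr (- 1 / 8) / (2 * k))\<^sup>2 / 4)"
      proof -
        have "4 * M < (real n powr (7/8) - 1) / (8 * (real c + 4)) * ((d * real n powr (- 1 / 8) / (2 * (real n powr (1/4) + 1)))\<^sup>2 / 4)"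
          using elim(2) by (simp only: M' L_def)
        also have "\<dots> \<le> real s / (8 * (real c + 4)) * ((d * real n powr (- 1 / 8) / (2 * k))\<^sup>2 / 4)"
        proof (intro mult_mono divide_right_mono power_mono divide_left_mono)
          show "real (2 * k) \<le> 2 * (real n powr (1 / 4) + 1)" using k by simp
        qed (use s k0 d n in \<open>auto intro!: mult_pos_pos add_nonneg_pos\<close>)
        finally show ?thesis .
      qed
      show "2 * M + 2 * (real s + n * d\<^sup>2) \<le> \<kappa> * n"
        unfolding M' d(2) L_def by (rule order_trans[OF _ elim(3)]) (use s(2) in simp)
    qed (simp_all add: D_def \<kappa>_def d_def M_def k)
    moreover have "((real n + 1) * (2 * real n ^ (c + 4) + 1)) ^ s * (1 / 2) ^ (n - 1) \<le> 1 / real n ^ \<alpha>"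
    proof -
      let ?b = "(real n + 1) * (2 * real n ^ (c + 4) + 1)"
      have "?b \<le> (2 * real n) * (3 * real n ^ (c + 4))"
        using n powpos(2)[of "c + 4"] by (intro mult_mono) auto
      also have "\<dots> = 6 * real n ^ (c + 5)" by (simp add: eval_nat_numeral)
      also have "\<dots> \<le> (real n)\<^sup>2 * real n ^ (c + 5)"
        using power_mono[of 16 "real n" 2] n by (intro mult_right_mono) auto
      also have "\<dots> = real n ^ (c + 7)" by (simp add: eval_nat_numeral)
      finally have b: "?b \<le> real n ^ (c + 7)" .
      have b0: "0 < ?b" using n powpos(1)[of "c + 4"] by (intro mult_pos_pos add_pos_pos) auto
      have "ln ?b \<le> ln (real n ^ (c + 7))" using b by (rule ln_le_cancel_iff[THEN iffD2, OF b0 powpos(1)])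
      then have lnb: "ln ?b \<le> (real c + 7) * L" by (simp only: lnpow of_nat_add of_nat_numeral)
      have "real s * ln ?b \<le> real s * ((real c + 7) * L)" using lnb by (intro mult_left_mono) auto
      also have "\<dots> \<le> real n powr (7 / 8) * ((real c + 7) * L)" using s(2) L0 by (intro mult_right_mono) auto
      finally have "real s * ln ?b - (real n - 1) * ln 2 \<le> - (real \<alpha> * L)" using elim(4) unfolding L_def by linarith
      then have "exp (real s * ln ?b - (real n - 1) * ln 2) \<le> exp (- (real \<alpha> * L))" by simp
      also have "exp (real s * ln ?b - (real n - 1) * ln 2) = ?b ^ s * (1 / 2) ^ (n - 1)"
        using b0 unfolding n1[symmetric] by (simp only: exp_diff exp_of_nat_mult) (simp add: power_divide)
      also have "exp (- (real \<alpha> * L)) = 1 / real n ^ \<alpha>"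
        using powpos(1)[of \<alpha>] by (simp add: exp_minus lnpow[symmetric] inverse_eq_divide)
      finally show ?thesis .
    qed
    moreover have "(4 * real n ^ (D + 2)) ^ m * (((real n + 1) * (4 * real n ^ D + 1)) ^ nat \<lfloor>64 * (\<kappa> * n)\<rfloor>
         * (4 * real n ^ D + 1) * (8192 * real n powr (- 3 / 16)) ^ (n - 1)) \<le> 1 / real n ^ \<alpha>"
    proof -
      define t where "t = nat \<lfloor>64 * (\<kappa> * n)\<rfloor>"
      have t: "real t \<le> 64 * (\<kappa> * n)" using \<kappa> unfolding t_def by simp
      let ?b1 = "4 * real n ^ (D + 2)" and ?b2 = "(real n + 1) * (4 * real n ^ D + 1)"
        and ?b3 = "4 * real n ^ D + 1" and ?b4 = "8192 * real n powr (- 3 / 16)"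
      have b0: "0 < ?b1" "0 < ?b2" "0 < ?b3" "0 < ?b4"
        using n powpos(1)[of "D + 2"] powpos(1)[of D] by (auto intro!: mult_pos_pos add_pos_pos)
      have "?b1 \<le> real n * real n ^ (D + 2)" using n powpos(1)[of "D + 2"] by (intro mult_right_mono) auto
      then have "?b1 \<le> real n ^ (D + 3)" by (simp add: eval_nat_numeral)
      then have "ln ?b1 \<le> ln (real n ^ (D + 3))" by (rule ln_le_cancel_iff[THEN iffD2, OF b0(1) powpos(1)])
      then have l1: "ln ?b1 \<le> (real D + 3) * L" by (simp only: lnpow of_nat_add of_nat_numeral)
      have b3: "?b3 \<le> 5 * real n ^ D" using powpos(2)[of D] by simp
      also have "\<dots> \<le> real n * real n ^ D" using n powpos(1)[of D] by (intro mult_right_mono) auto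
      finally have "?b3 \<le> real n ^ (D + 1)" by simp
      then have "ln ?b3 \<le> ln (real n ^ (D + 1))" by (rule ln_le_cancel_iff[THEN iffD2, OF b0(3) powpos(1)])
      then have l3: "ln ?b3 \<le> (real D + 1) * L" by (simp only: lnpow of_nat_add of_nat_1)
      have "?b2 \<le> (2 * real n) * (5 * real n ^ D)"
        using n b3 powpos(1)[of D] by (intro mult_mono) auto
      also have "\<dots> = 10 * (real n * real n ^ D)" by simp
      also have "\<dots> \<le> real n * (real n * real n ^ D)" using n powpos(1)[of D] by (intro mult_right_mono) auto
      finally have "?b2 \<le> real n ^ (D + 2)" by (simp add: eval_nat_numeral)
      then have "ln ?b2 \<le> ln (real n ^ (D + 2))" by (rule ln_le_cancel_iff[THEN iffD2, OF b0(2) powpos(1)])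
      then have l2: "ln ?b2 \<le> (real D + 2) * L" by (simp only: lnpow of_nat_add of_nat_numeral)
      have l4: "ln ?b4 = ln 8192 - 3 / 16 * L" using n by (simp add: ln_mult ln_powr L_def)
      have "real m * ln ?b1 \<le> real m * ((real D + 3) * L)" using l1 by (intro mult_left_mono) auto
      also have "\<dots> \<le> (256 * (ln 16 + real D * L) + 2) * ((real D + 3) * L)"
        using m(2) L0 by (intro mult_right_mono) auto
      finally have e1: "real m * ln ?b1 \<le> \<dots>" .
      have "real t * ln ?b2 \<le> real t * ((real D + 2) * L)" using l2 by (intro mult_left_mono) auto
      also have "\<dots> \<le> 64 * (\<kappa> * n) * ((real D + 2) * L)" using t L0 by (intro mult_right_mono) auto
      also have "\<dots> = real n / 32 * L" by (simp add: \<kappa>_def field_simps)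
      finally have e2: "real t * ln ?b2 \<le> real n / 32 * L" .
      have "real m * ln ?b1 + real t * ln ?b2 + ln ?b3 + (real n - 1) * ln ?b4 \<le> - (real \<alpha> * L)"
        using e1 e2 l3 elim(5) unfolding l4 L_def by linarith
      then have "exp (real m * ln ?b1 + real t * ln ?b2 + ln ?b3 + (real n - 1) * ln ?b4) \<le> exp (- (real \<alpha> * L))" by simp
      also have "exp (real m * ln ?b1 + real t * ln ?b2 + ln ?b3 + (real n - 1) * ln ?b4) =
        ?b1 ^ m * (?b2 ^ t * ?b3 * ?b4 ^ (n - 1))"
        unfolding n1[symmetric] exp_add exp_of_nat_mult exp_ln[OF b0(1)] exp_ln[OF b0(2)] exp_ln[OF b0(3)] exp_ln[OF b0(4)]
        by (simp only: mult.assoc)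
      also have "exp (- (real \<alpha> * L)) = 1 / real n ^ \<alpha>"
        using powpos(1)[of \<alpha>] by (simp add: exp_minus lnpow[symmetric] inverse_eq_divide)
      finally show ?thesis by (simp only: t_def)
    qed
    ultimately show ?case by blast
  qed
qed

section \<open>Assembly of the exceptional events\<close>

theorem corollary2p6:
  fixes A C :: real
  shows "\<exists>B::real. \<forall>\<^sub>F n in sequentially.
    \<forall>M \<in> carrier_mat n n.
      (\<forall>i<n. \<forall>j<n. \<bar>M $$ (i, j)\<bar> \<le> real n powr C) \<longrightarrow>
      measure_pmf.prob (random_bernoulli_mat n)
        {N. cond_number (M + N) \<ge> ereal (real n powr B)} \<le> real n powr (- A)"
proof -
  obtain c :: nat where c: "C \<le> real c" using real_arch_simple by blast
  \<comment> \<open>The additional 2 pays for three events in each of \<open>n\<close> rows: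
    \<open>3 * n \<le> n\<^sup>2\<close>.\<close>
  obtain \<alpha> :: nat where \<alpha>: "A + 2 \<le> real \<alpha>" using real_arch_simple by blast
  define D where "D = c + 6 + (c + 3) * (16 * \<alpha>)"
  define \<kappa> where "\<kappa> = 1 / (2048 * (real D + 2))"
  show ?thesis
  \<comment> \<open>Entries of \<open>M + N\<close> are at most \<open>2 * n ^ c\<close>, so
    near-normality up to \<open>1 / n ^ D\<close> requires \<open>n ^ 4 * (2 * n ^ c)\<close> to be
    at most \<open>n ^ B / n ^ D\<close>. The exponent \<open>D + c + 6\<close> suffices because
    \<open>2 \<le> n\<^sup>2\<close>.\<close>
  proof (intro exI[of _ "real (D + c + 6)"])
    show "\<forall>\<^sub>F n in sequentially.
    \<forall>M \<in> carrier_mat n n.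
      (\<forall>i<n. \<forall>j<n. \<bar>M $$ (i, j)\<bar> \<le> real n powr C) \<longrightarrow>
      measure_pmf.prob (random_bernoulli_mat n)
        {N. cond_number (M + N) \<ge> ereal (real n powr real (D + c + 6))} \<le> real n powr (- A)"
      using eventually_scales[of c \<alpha>, folded D_def, folded \<kappa>_def]
    proof eventually_elim
      case (elim n)
      then obtain s k m T d where "scales n c \<alpha> D s k m T \<kappa> d"
        and sparse: "((real n + 1) * (2 * real n ^ (c + 4) + 1)) ^ s * (1 / 2) ^ (n - 1) \<le> 1 / real n ^ \<alpha>"
        and dense: "(4 * real n ^ (D + 2)) ^ m * (((real n + 1) * (4 * real n ^ D + 1)) ^ nat \<lfloor>64 * (\<kappa> * n)\<rfloor>
         * (4 * real n ^ D + 1) * (8192 * real n powr (- 3 / 16)) ^ (n - 1)) \<le> 1 / real n ^ \<alpha>"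
        by blast
      then interpret scales n c \<alpha> D s k m T \<kappa> d by simp
      show ?case
      proof (intro ballI impI)
        fix M :: "real mat"
        assume M: "M \<in> carrier_mat n n" and small: "\<forall>i<n. \<forall>j<n. \<bar>M $$ (i, j)\<bar> \<le> real n powr C"
        have R: "\<bar>M $$ (i, j)\<bar> \<le> real n ^ c" if "i < n" "j < n" for i j
        proof -
          have "\<bar>M $$ (i, j)\<bar> \<le> real n powr C" using small that by blast
          also have "\<dots> \<le> real n powr real c" using c n_pow_ge(1) by (intro powr_mono) auto
          also have "\<dots> = real n ^ c" using n_pow_ge(4) by (simp only: powr_realpow)
          finally show ?thesis .
        qed
        define \<epsilon> where "\<epsilon> = 1 / real n ^ D"
        define nrm where "nrm f l x \<longleftrightarrow> (\<forall>i<n. i \<noteq> l \<longrightarrow> (\<Sum>j<n. (M $$ (i, j) + f (i, j)) * x j) = 0)"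
          for f l and x :: "nat \<Rightarrow> real"
        define unit where "unit x \<longleftrightarrow> (\<Sum>j<n. (x j)\<^sup>2) = 1" for x :: "nat \<Rightarrow> real"
        define big where "big x = card {i\<in>{..<n}. 1 / real n ^ (c + 4) < \<bar>x i\<bar>}" for x :: "nat \<Rightarrow> real"
        \<comment> \<open>Every unit normal of the rows other than \<open>l\<close> is poor, sparse,
          or dense and rich. \<open>G\<close> covers the poor case together with near-orthogonality
          to row \<open>l\<close>; \<open>S\<close> and \<open>E\<close> cover the others, where the
          mere existence of the normal is unlikely.\<close>
        define G where "G l = {f. (\<exists>x. (unit x \<and> conc {..<n} x \<epsilon> \<le> 1 / real n ^ \<alpha>) \<and> nrm f l x) \<and>
          (\<forall>x. unit x \<longrightarrow> nrm f l x \<longrightarrow> \<bar>\<Sum>j<n. (M $$ (l, j) + f (l, j)) * x j\<bar> \<le> \<epsilon>)}" for l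
        define S where "S l = {f. \<exists>x. unit x \<and> big x \<le> s \<and> nrm f l x}" for l
        define E where "E l = {f. \<exists>x. unit x \<and> s < big x \<and> 1 / real n ^ \<alpha> < conc {..<n} x \<epsilon> \<and> nrm f l x}" for l
        let ?p = "signs ({..<n} \<times> {..<n})"
        have PG: "measure_pmf.prob ?p (G l) \<le> 1 / real n ^ \<alpha>" if "l < n" for l
          unfolding G_def nrm_def
        proof (rule prob_row_near_normal_le[OF that])
          fix x z assume "unit x \<and> conc {..<n} x \<epsilon> \<le> 1 / real n ^ \<alpha>"
          then show "measure_pmf.prob (signs {..<n}) {\<xi>. \<bar>(\<Sum>j<n. \<xi> j * x j) - z\<bar> \<le> \<epsilon>} \<le> 1 / real n ^ \<alpha>"
            using prob_le_conc order_trans by blast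
        qed auto
        have PS: "measure_pmf.prob ?p (S l) \<le> 1 / real n ^ \<alpha>" if "l < n" for l
          unfolding S_def nrm_def unit_def big_def
          by (rule order_trans[OF sparse_normal_prob_le[OF R that] sparse])
        have PE: "measure_pmf.prob ?p (E l) \<le> 1 / real n ^ \<alpha>" if "l < n" for l
          unfolding E_def nrm_def unit_def big_def \<epsilon>_def
          by (rule order_trans[OF dense_rich_normal_prob_le[OF R that] dense])
        have "measure_pmf.prob (random_bernoulli_mat n) {N. cond_number (M + N) \<ge> ereal (real n powr real (D + c + 6))}
          = measure_pmf.prob ?p {f. ereal (real n powr real (D + c + 6)) \<le> cond_number (M + Matrix.mat n n f)}"
          by (simp add: random_bernoulli_mat_def signs_def vimage_def)
        also have "\<dots> \<le> measure_pmf.prob ?p (\<Union>l\<in>{..<n}. G l \<union> (S l \<union> E l))"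
        proof (rule prob_mono_support)
          fix f assume f: "f \<in> set_pmf ?p"
            and "f \<in> {f. ereal (real n powr real (D + c + 6)) \<le> cond_number (M + Matrix.mat n n f)}"
          moreover define T where "T = M + Matrix.mat n n f"
          ultimately have \<kappa>T: "ereal (real n powr real (D + c + 6)) \<le> cond_number T" by simp
          have Tc: "T \<in> carrier_mat n n" using M by (simp add: T_def)
          have Tij: "T $$ (i, j) = M $$ (i, j) + f (i, j)" if "i < n" "j < n" for i j
            using M that by (simp add: T_def)
          have Tb: "\<bar>T $$ (i, j)\<bar> \<le> 2 * real n ^ c" if "i < n" "j < n" for i j
            unfolding Tij[OF that] using R[OF that] n_pow_ge(2)[of c]
              abs_signs_le_1[OF finite_cartesian_product[OF finite_lessThan finite_lessThan] f, of "(i, j)"]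
            by linarith
          have "\<exists>l<n. \<forall>x :: nat \<Rightarrow> real. (\<Sum>j<n. (x j)\<^sup>2) = 1 \<longrightarrow>
            (\<forall>i<n. i \<noteq> l \<longrightarrow> (\<Sum>j<n. T $$ (i, j) * x j) = 0) \<longrightarrow> \<bar>\<Sum>j<n. T $$ (l, j) * x j\<bar> \<le> \<epsilon>"
          proof (rule cond_number_large_imp_near_normal[OF Tc _ Tb _ \<kappa>T])
            have "real n ^ 4 * (2 * real n ^ c) \<le> real n ^ 4 * ((real n)\<^sup>2 * real n ^ c)"
              using power_mono[of 8 "real n" 2] n_pow_ge by (intro mult_left_mono mult_right_mono) auto
            also have "\<dots> = real n ^ (D + c + 6) * \<epsilon>"
              using n_pow_ge(4) by (simp add: \<epsilon>_def power_add power2_eq_square eval_nat_numeral)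
            finally show "real n ^ 4 * (2 * real n ^ c) \<le> real n powr real (D + c + 6) * \<epsilon>"
              using n_pow_ge(4) by (simp only: powr_realpow)
          qed (use n_pow_ge in \<open>auto simp: \<epsilon>_def\<close>)
          then obtain l where l: "l < n" and near: "\<And>x. unit x \<Longrightarrow> nrm f l x \<Longrightarrow> \<bar>\<Sum>j<n. (M $$ (l, j) + f (l, j)) * x j\<bar> \<le> \<epsilon>"
            unfolding unit_def nrm_def by (auto simp: Tij)
          obtain x where x: "unit x" "nrm f l x"
            using exists_unit_normal[OF l, of "\<lambda>i j. M $$ (i, j) + f (i, j)"] unfolding unit_def nrm_def by blast
          have "f \<in> G l \<union> (S l \<union> E l)"
          proof (cases "conc {..<n} x \<epsilon> \<le> 1 / real n ^ \<alpha>")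
            case True
            then have "f \<in> G l" using x near unfolding G_def by blast
            then show ?thesis by blast
          next
            case False
            then have "f \<in> S l \<or> f \<in> E l" using x unfolding S_def E_def by (cases "big x \<le> s") (auto simp: not_le)
            then show ?thesis by blast
          qed
          then show "f \<in> (\<Union>l\<in>{..<n}. G l \<union> (S l \<union> E l))" using l by blast
        qed
        also have "\<dots> \<le> (\<Sum>l<n. measure_pmf.prob ?p (G l \<union> (S l \<union> E l)))"
          by (rule measure_pmf.finite_measure_subadditive_finite) auto
        also have "\<dots> \<le> (\<Sum>l<n. 3 / real n ^ \<alpha>)"
        proof (rule sum_mono)
          fix l assume l: "l \<in> {..<n}"
          have "measure_pmf.prob ?p (G l \<union> (S l \<union> E l)) \<le> measure_pmf.prob ?p (G l) + measure_pmf.prob ?p (S l \<union> E l)"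
            by (rule measure_Un_le) auto
          also have "measure_pmf.prob ?p (S l \<union> E l) \<le> measure_pmf.prob ?p (S l) + measure_pmf.prob ?p (E l)"
            by (rule measure_Un_le) auto
          finally show "measure_pmf.prob ?p (G l \<union> (S l \<union> E l)) \<le> 3 / real n ^ \<alpha>"
            using PG[of l] PS[of l] PE[of l] l by simp
        qed
        also have "\<dots> = 3 * real n / real n ^ \<alpha>" by simp
        also have "\<dots> \<le> (real n)\<^sup>2 / real n ^ \<alpha>"
          using n_pow_ge by (intro divide_right_mono) (auto simp: power2_eq_square)
        also have "\<dots> = real n powr (2 - real \<alpha>)"
          using n_pow_ge(4) by (simp add: powr_diff powr_realpow)
        also have "\<dots> \<le> real n powr (- A)" using \<alpha> n_pow_ge(1) by (intro powr_mono) auto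
        finally show "measure_pmf.prob (random_bernoulli_mat n)
            {N. cond_number (M + N) \<ge> ereal (real n powr real (D + c + 6))} \<le> real n powr (- A)" .
      qed
    qed
  qed
qed

end
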